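(* Let $q\in(0,\infty]$ and let $b$ be a slowly varying function with $\lVert t^{-1/q}b(t)\chi_{(1,\infty)}(t)\rVert_q<\infty$. Put, for $t\in(0,\infty)$, $$a(t)=\left(\int_t^\infty s^{-1}b^q(s)\,ds\right)^{1/q}\ \text{ if } q<\infty,\qquad a(t)=\operatorname*{ess\,sup}_{s\in(t,\infty)}b(s)\ \text{ if } q=\infty .$$ Then the fundamental function $\varphi_X$ of $X=L^{(1,q,b)}$ satisfies $$\varphi_X(t)\approx t\,a(t)\quad\text{for } t\in(0,\infty),\qquad \varphi_X(\infty)=\infty .$$ Consequently $\varphi_X$ is in all cases equivalent to a quasi-concave function, and the corresponding Lorentz and Marcinkiewicz endpoint spaces are $$\Lambda_{\varphi_X}=L^{1,1,a},\qquad M_{\varphi_X}=L^{(1,\infty,a)},$$ up to equivalence of the defining functionals.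
   Context: $(R,\mu)$ is a $\sigma$-finite non-atomic measure space with $\mu(R)=\infty$; $M=M(R,\mu)$ is the set of extended complex-valued $\mu$-measurable functions on $R$. For $f\in M$, $f^*(t)=\inf\{s\ge 0:\mu(\{|f|>s\})\le t\}$ and $f^{**}(t)=\frac1t\int_0^t f^*(s)\,ds$. Two non-negative functions (or functionals) $g,h$ are equivalent, $g\approx h$, if there are constants $0<c\le C<\infty$ with $cg\le h\le Cg$. Convention: $1/\infty=0$. A measurable $b:(0,\infty)\to(0,\infty)$ is slowly varying if for every $\varepsilon>0$ there are a non-decreasing function $b_\varepsilon$ and a non-increasing function $b_{-\varepsilon}$ with $t^\varepsilon b(t)\approx b_\varepsilon(t)$ and $t^{-\varepsilon}b(t)\approx b_{-\varepsilon}(t)$ on $(0,\infty)$. For $f\in M$, $\lVert f\rVert_{p,q,b}=\lVert t^{1/p-1/q}b(t)f^*(t)\rVert_q$ and $\lVert f\rVert_{(p,q,b)}=\lVert t^{1/p-1/q}b(t)f^{**}(t)\rVert_q$, where $\lVert\cdot\rVert_q$ is the Lebesgue $L^q$ (quasi)norm over $(0,\infty)$ in the variable $t$; $L^{p,q,b}$ and $L^{(p,q,b)}$ are the sets of $f\in M$ for which the respective functional is finite. The fundamental function of such a space $X$ with functional $\lVert\cdot\rVert_X$ is $\varphi_X(t)=\lVert\chi_E\rVert_X$, where $E\subseteq R$ is any measurable set with $\mu(E)=t$, $t\in[0,\infty]$ (so $\varphi_X(0)=0$). A function $\varphi:[0,\infty)\to[0,\infty)$ is quasi-concave if it is non-decreasing,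 vanishes only at $0$, and $t\mapsto t/\varphi(t)$ is non-decreasing on $(0,\infty)$. Every quasi-concave function is equivalent to a non-decreasing concave function vanishing at $0$. If $\varphi$ is equivalent to a quasi-concave function, pick a non-decreasing concave $\psi\approx\varphi$ on $[0,\infty)$ with $\psi(0)=0$. The Marcinkiewicz endpoint space $M_\varphi$ is $\{f\in M:\sup_{t>0}\psi(t)f^{**}(t)<\infty\}$ with this supremum as norm; the Lorentz endpoint space $\Lambda_\varphi$ is $\{f\in M:\int_0^\infty f^*\,d\psi<\infty\}$ with this Lebesgue--Stieltjes integral over $[0,\infty)$ (including a possible atom of mass $\psi(0^+)$ at $0$) as norm. Up to equivalence of norms these do not depend on the choice of $\psi$. *)

theory Defs
  imports "HOL-Analysis.Analysis" "HOL-Probability.Essential_Supremum"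
begin

definition non_atomic :: "'a measure \<Rightarrow> bool" where
  "non_atomic M \<longleftrightarrow>
     (\<forall>A\<in>sets M. emeasure M A > 0 \<longrightarrow>
        (\<exists>B\<in>sets M. B \<subseteq> A \<and> 0 < emeasure M B \<and> emeasure M B < emeasure M A))"

text \<open>The extended complex plane, i.e. the complex numbers with one point at infinity added.\<close>

datatype ecomplex = Fin complex | Infty

fun emod :: "ecomplex \<Rightarrow> ennreal" where
  "emod (Fin z) = ennreal (cmod z)"
| "emod Infty = \<infinity>"

text \<open>Measurability with respect to the Borel sets of the extended complex plane; these are
  generated by the (images of the) Borel sets of the complex plane together with the point at
  infinity.\<close>

definition meas_funs :: "'a measure \<Rightarrow> ('a \<Rightarrow> ecomplex) set" where
  "meas_funs M = {f. {x \<in> space M. f x = Infty} \<in> sets M \<and>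
                     (\<forall>B\<in>sets borel. {x \<in> space M. f x \<in> Fin ` B} \<in> sets M)}"

definition char_fun :: "'a set \<Rightarrow> 'a \<Rightarrow> ecomplex" where
  "char_fun E x = (if x \<in> E then Fin 1 else Fin 0)"

definition rearr :: "'a measure \<Rightarrow> ('a \<Rightarrow> ecomplex) \<Rightarrow> real \<Rightarrow> ennreal" where
  "rearr M f t =
     Inf {ennreal s |s. 0 \<le> s \<and> emeasure M {x \<in> space M. emod (f x) > ennreal s} \<le> ennreal t}"

definition avg_rearr :: "'a measure \<Rightarrow> ('a \<Rightarrow> ecomplex) \<Rightarrow> real \<Rightarrow> ennreal" where
  "avg_rearr M f t = (\<integral>\<^sup>+ s. rearr M f s \<partial>lebesgue_on {0<..<t}) / ennreal t"

text \<open>All functions and functionals are compared as functions with values in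
  \<open>[0, \<infinity>]\<close>; real-valued ones are embedded by \<^const>\<open>ennreal\<close>.\<close>

definition equiv_on :: "'b set \<Rightarrow> ('b \<Rightarrow> ennreal) \<Rightarrow> ('b \<Rightarrow> ennreal) \<Rightarrow> bool" where
  "equiv_on D g h \<longleftrightarrow>
     (\<exists>c C::real. 0 < c \<and> c \<le> C \<and>
        (\<forall>x\<in>D. ennreal c * g x \<le> h x \<and> h x \<le> ennreal C * g x))"

text \<open>Functions on \<open>(0, \<infinity>)\<close> are functions on the reals whose values
  outside \<open>(0, \<infinity>)\<close> are irrelevant.\<close>

definition slowly_varying :: "(real \<Rightarrow> real) \<Rightarrow> bool" where
  "slowly_varying b \<longleftrightarrow>
     b \<in> borel_measurable (lebesgue_on {0<..}) \<and> (\<forall>t>0. 0 < b t) \<and>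
     (\<forall>\<epsilon>>0. \<exists>u v. (\<forall>t>0. 0 \<le> u t \<and> 0 \<le> v t) \<and>
        mono_on {0<..} u \<and> antimono_on {0<..} v \<and>
        equiv_on {0<..} (\<lambda>t. ennreal (t powr \<epsilon> * b t)) (\<lambda>t. ennreal (u t)) \<and>
        equiv_on {0<..} (\<lambda>t. ennreal (t powr (- \<epsilon>) * b t)) (\<lambda>t. ennreal (v t)))"

text \<open>Only used for positive exponents.\<close>

definition ennreal_powr :: "ennreal \<Rightarrow> real \<Rightarrow> ennreal" where
  "ennreal_powr x p = (if x = \<infinity> then \<infinity> else ennreal (enn2real x powr p))"

definition Lq_norm :: "ennreal \<Rightarrow> (real \<Rightarrow> ennreal) \<Rightarrow> ennreal" where
  "Lq_norm q g =
     (if q = \<infinity> then esssup (lebesgue_on {0<..}) g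
      else ennreal_powr (\<integral>\<^sup>+ t. ennreal_powr (g t) (enn2real q) \<partial>lebesgue_on {0<..})
             (1 / enn2real q))"

text \<open>The reciprocal of an exponent in \<open>(0, \<infinity>]\<close>, with \<open>1 / \<infinity> = 0\<close>.\<close>

definition recip :: "ennreal \<Rightarrow> real" where
  "recip p = enn2real (1 / p)"

definition lk_norm ::
  "'a measure \<Rightarrow> ennreal \<Rightarrow> ennreal \<Rightarrow> (real \<Rightarrow> ennreal) \<Rightarrow> ('a \<Rightarrow> ecomplex) \<Rightarrow> ennreal" where
  "lk_norm M p q w f = Lq_norm q (\<lambda>t. ennreal (t powr (recip p - recip q)) * w t * rearr M f t)"

definition lk_avg_norm ::
  "'a measure \<Rightarrow> ennreal \<Rightarrow> ennreal \<Rightarrow> (real \<Rightarrow> ennreal) \<Rightarrow> ('a \<Rightarrow> ecomplex) \<Rightarrow> ennreal" where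
  "lk_avg_norm M p q w f =
     Lq_norm q (\<lambda>t. ennreal (t powr (recip p - recip q)) * w t * avg_rearr M f t)"

definition lk_space ::
  "'a measure \<Rightarrow> ennreal \<Rightarrow> ennreal \<Rightarrow> (real \<Rightarrow> ennreal) \<Rightarrow> ('a \<Rightarrow> ecomplex) set" where
  "lk_space M p q w = {f \<in> meas_funs M. lk_norm M p q w f < \<infinity>}"

definition lk_avg_space ::
  "'a measure \<Rightarrow> ennreal \<Rightarrow> ennreal \<Rightarrow> (real \<Rightarrow> ennreal) \<Rightarrow> ('a \<Rightarrow> ecomplex) set" where
  "lk_avg_space M p q w = {f \<in> meas_funs M. lk_avg_norm M p q w f < \<infinity>}"

definition tail_weight :: "ennreal \<Rightarrow> (real \<Rightarrow> real) \<Rightarrow> real \<Rightarrow> ennreal" where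
  "tail_weight q b t =
     (if q = \<infinity> then esssup (lebesgue_on {t<..}) (\<lambda>s. ennreal (b s))
      else ennreal_powr
             (\<integral>\<^sup>+ s. ennreal (inverse s * b s powr enn2real q) \<partial>lebesgue_on {t<..})
             (1 / enn2real q))"

definition fundamental_function ::
  "'a measure \<Rightarrow> (('a \<Rightarrow> ecomplex) \<Rightarrow> ennreal) \<Rightarrow> ennreal \<Rightarrow> ennreal" where
  "fundamental_function M N t =
     (THE v. \<exists>E\<in>sets M. emeasure M E = t \<and> v = N (char_fun E))"

definition quasi_concave :: "(real \<Rightarrow> real) \<Rightarrow> bool" where
  "quasi_concave \<phi> \<longleftrightarrow>
     (\<forall>t\<ge>0. 0 \<le> \<phi> t) \<and> mono_on {0..} \<phi> \<and> (\<forall>t\<ge>0. \<phi> t = 0 \<longleftrightarrow> t = 0) \<and>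
     mono_on {0<..} (\<lambda>t. t / \<phi> t)"

text \<open>The admissible choices of a concave function in the definition of the endpoint spaces of
  a space with fundamental function \<open>\<phi>\<close>.\<close>

definition concave_representative :: "(ennreal \<Rightarrow> ennreal) \<Rightarrow> (real \<Rightarrow> real) \<Rightarrow> bool" where
  "concave_representative \<phi> \<psi> \<longleftrightarrow>
     mono_on {0..} \<psi> \<and> concave_on {0..} \<psi> \<and> \<psi> 0 = 0 \<and>
     equiv_on {0..} (\<lambda>t. \<phi> (ennreal t)) (\<lambda>t. ennreal (\<psi> t))"

definition marcinkiewicz_norm ::
  "'a measure \<Rightarrow> (real \<Rightarrow> real) \<Rightarrow> ('a \<Rightarrow> ecomplex) \<Rightarrow> ennreal" where
  "marcinkiewicz_norm M \<psi> f = (SUP t\<in>{0<..}. ennreal (\<psi> t) * avg_rearr M f t)"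

definition marcinkiewicz_space :: "'a measure \<Rightarrow> (real \<Rightarrow> real) \<Rightarrow> ('a \<Rightarrow> ecomplex) set" where
  "marcinkiewicz_space M \<psi> = {f \<in> meas_funs M. marcinkiewicz_norm M \<psi> f < \<infinity>}"

text \<open>\<^const>\<open>interval_measure\<close> requires a right-continuous function on all reals, so \<open>\<psi>\<close> is
  replaced by its right limits and extended by \<open>0\<close> to the negative reals. The jump of the
  resulting function at \<open>0\<close> is the atom of mass \<open>\<psi>(0+)\<close>.\<close>

definition stieltjes_measure :: "(real \<Rightarrow> real) \<Rightarrow> real measure" where
  "stieltjes_measure \<psi> = interval_measure (\<lambda>t. if t < 0 then 0 else Lim (at_right t) \<psi>)"

definition lorentz_norm ::
  "'a measure \<Rightarrow> (real \<Rightarrow> real) \<Rightarrow> ('a \<Rightarrow> ecomplex) \<Rightarrow> ennreal" where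
  "lorentz_norm M \<psi> f = (\<integral>\<^sup>+ t\<in>{0..}. rearr M f t \<partial>stieltjes_measure \<psi>)"

definition lorentz_space :: "'a measure \<Rightarrow> (real \<Rightarrow> real) \<Rightarrow> ('a \<Rightarrow> ecomplex) set" where
  "lorentz_space M \<psi> = {f \<in> meas_funs M. lorentz_norm M \<psi> f < \<infinity>}"

end

theory Submission
  imports Defs
begin

text \<open>For \<open>\<mu>(E) = r\<close> one has \<open>(\<chi>\<^sub>E)\<^sup>*\<^sup>*(t) = min(1, r/t)\<close>, so \<open>\<phi>\<^sub>X(r)\<close> is the norm of \<open>b(t) min(t, r)\<close>
  in \<open>L\<^sup>q(dt/t)\<close>. Slow variation makes \<open>t\<^bsup>1/2\<^esup> b(t)\<close> almost increasing, so the part over \<open>(0, r)\<close> is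
  dominated by \<open>r b(r)\<close>, hence by the part over \<open>(r, \<infinity>)\<close>, which is \<open>r a(r)\<close>. For the same reason
  \<open>a(s)\<close> is dominated by \<open>(t/s)\<^bsup>1/2\<^esup> a(t)\<close> for \<open>s \<le> t\<close>. Hence \<open>t a(t)\<close> is equivalent both to a
  concave function and to the primitive of \<open>a\<close>; the former settles quasi-concavity and the
  latter, tested on superlevel sets of \<open>f\<^sup>*\<close>, compares \<open>d\<psi>\<close> with \<open>a(t) dt\<close>.\<close>

section \<open>Non-atomic measures and rearrangements\<close>

text \<open>For \<open>q\<close> below 1 the functionals are only quasi-norms, and for infinite
  \<open>q\<close> they are essential suprema. So estimates do not add functions: a function is
  dominated at each point by one of two others, at the price of the factor
  \<open>2 powr recip q\<close>. In the form \<open>log_norm\<close> only three model functions have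
  to be computed: \<open>sqrt t\<close> up to \<open>r\<close>, \<open>1 / sqrt t\<close> beyond
  \<open>r\<close>, and the indicator of the interval from \<open>r\<close> to \<open>2 * r\<close>.
  The exponent 1/2 works because it lies strictly between 0 and 1. After one factor
  \<open>sqrt t\<close> has been spent on the almost monotonicity of \<open>b\<close>, another one
  is left over from \<open>t\<close>, and it makes the norm near 0 converge; likewise the bound of
  a(s) by a multiple of \<open>s powr (- 1 / 2)\<close> is integrable at 0. Two further obstacles:
  the value of \<open>fundamental_function\<close> is a definite description, so sets of every
  measure have to exist; and the endpoint spaces are claimed for every admissible concave function,
  whose possible atom at 0 has to be excluded from its equivalence to t a(t) alone.\<close>

lemma non_atomic_obtain_small:
  assumes "non_atomic M" "A \<in> sets M" "0 < emeasure M A" "0 < e"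
  obtains B where "B \<in> sets M" "B \<subseteq> A" "0 < emeasure M B" "emeasure M B < e"
proof -
  \<comment> \<open>\<open>A\<close> may have infinite measure. A subset of strictly smaller measure
    has finite measure, so that repeated halving tends to 0.\<close>
  obtain B0 where B0: "B0 \<in> sets M" "B0 \<subseteq> A" "0 < emeasure M B0" "emeasure M B0 < emeasure M A"
    using assms unfolding non_atomic_def by blast
  \<comment> \<open>A set \<open>B\<close> is split into \<open>C\<close> and \<open>B - C\<close>,
    both of positive measure; the smaller of the two has at most half the measure of
    \<open>B\<close>.\<close>
  have halve: "\<exists>B\<in>sets M. B \<subseteq> B0 \<and> 0 < emeasure M B \<and> 2 ^ n * emeasure M B \<le> emeasure M B0" for n
  proof (induction n)
    case 0
    then show ?case using B0 by auto
  next
    case (Suc n)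
    then obtain B where B: "B \<in> sets M" "B \<subseteq> B0" "0 < emeasure M B"
      "2 ^ n * emeasure M B \<le> emeasure M B0" by blast
    then obtain C where C: "C \<in> sets M" "C \<subseteq> B" "0 < emeasure M C" "emeasure M C < emeasure M B"
      using assms(1) unfolding non_atomic_def by blast
    have sum: "emeasure M C + emeasure M (B - C) = emeasure M B"
      using B C by (subst plus_emeasure) (auto simp: Un_absorb1)
    have pos: "0 < emeasure M (B - C)"
      using sum C(4) by (metis add.right_neutral less_irrefl not_gr_zero)
    have halve: "2 ^ Suc n * x \<le> emeasure M B0" if "x + x \<le> emeasure M B" for x
    proof -
      have "2 ^ Suc n * x = 2 ^ n * (x + x)" 
        by (simp add: mult_2[symmetric] mult.assoc mult.left_commute)
      also have "\<dots> \<le> 2 ^ n * emeasure M B" using that by (rule mult_left_mono) simp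
      finally show ?thesis using B(4) by simp
    qed
    show ?case
    proof (cases "emeasure M C \<le> emeasure M (B - C)")
      case True
      then have "emeasure M C + emeasure M C \<le> emeasure M B"
        unfolding sum[symmetric] by (rule add_left_mono)
      then show ?thesis using halve B C by (intro bexI[of _ C]) auto
    next
      case False
      then have "emeasure M (B - C) + emeasure M (B - C) \<le> emeasure M B"
        unfolding sum[symmetric] by (intro add_right_mono) simp
      then show ?thesis using halve B C pos by (intro bexI[of _ "B - C"]) auto
    qed
  qed
  have "(\<lambda>n. ennreal (1 / 2) ^ n * emeasure M B0) \<longlonglongrightarrow> 0 * emeasure M B0"
  proof (intro tendsto_mult_ennreal tendsto_const)
    have "(\<lambda>n. ennreal ((1 / 2) ^ n)) \<longlonglongrightarrow> ennreal 0"
      by (intro tendsto_ennrealI LIMSEQ_power_zero) simp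
    moreover have "ennreal (1 / 2) ^ n = ennreal ((1 / 2) ^ n)" for n
      by (rule ennreal_power) simp
    ultimately show "(\<lambda>n. ennreal (1 / 2) ^ n) \<longlonglongrightarrow> 0" unfolding ennreal_0 by simp
  qed (use B0 in auto)
  then have "eventually (\<lambda>n. ennreal (1 / 2) ^ n * emeasure M B0 < e) sequentially"
    using \<open>0 < e\<close> by (intro order_tendstoD) auto
  then obtain n where n: "ennreal (1 / 2) ^ n * emeasure M B0 < e"
    by (auto simp: eventually_sequentially)
  obtain B where B: "B \<in> sets M" "B \<subseteq> B0" "0 < emeasure M B"
    "2 ^ n * emeasure M B \<le> emeasure M B0" using halve by blast
  have "ennreal (1 / 2) ^ n * 2 ^ n = (1::ennreal)"
  proof -
    have "ennreal (1 / 2) * ennreal 2 = ennreal (1 / 2 * 2)"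
      by (rule ennreal_mult[symmetric]) auto
    then have "ennreal (1 / 2) * 2 = 1" unfolding ennreal_numeral by simp
    then show ?thesis unfolding power_mult_distrib[symmetric] by (simp only: power_one)
  qed
  then have "emeasure M B = ennreal (1 / 2) ^ n * (2 ^ n * emeasure M B)"
    by (simp add: mult.assoc[symmetric])
  also have "\<dots> \<le> ennreal (1 / 2) ^ n * emeasure M B0"
    using B(4) by (rule mult_left_mono) simp
  also have "\<dots> < e" by fact
  finally show thesis using B B0(2) by (intro that[of B]) auto
qed

text \<open>Greedy exhaustion: at each stage add a set of at least half the largest measure that still
  fits below \<open>t\<close>.\<close>

lemma non_atomic_obtain_emeasure:
  assumes "non_atomic M" "emeasure M (space M) = \<infinity>"
  obtains E where "E \<in> sets M" "emeasure M E = t"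
proof (cases "t = \<infinity>")
  case True
  then show thesis using assms(2) by (intro that[of "space M"]) auto
next
  case False
  define P where "P E \<longleftrightarrow> E \<in> sets M \<and> emeasure M E \<le> t" for E
  define Q where "Q E F \<longleftrightarrow> E \<subseteq> F \<and> (\<forall>G\<in>sets M. G \<inter> E = {} \<longrightarrow> emeasure M E + emeasure M G \<le> t
    \<longrightarrow> emeasure M G \<le> 2 * emeasure M (F - E))" for E F
  have step: "\<exists>F. P F \<and> Q E F" if E: "P E" for E
  proof -
    define S where "S = {emeasure M G |G. G \<in> sets M \<and> G \<inter> E = {} \<and> emeasure M E + emeasure M G \<le> t}"
    have S_le: "x \<le> t" if "x \<in> S" for x
      using that unfolding S_def by (auto intro: order_trans[rotated])
    have upper: "emeasure M G \<le> Sup S"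
      if "G \<in> sets M" "G \<inter> E = {}" "emeasure M E + emeasure M G \<le> t" for G
      using that by (intro Sup_upper) (auto simp: S_def)
    show ?thesis
    proof (cases "Sup S = 0")
      case True
      then show ?thesis using E upper unfolding Q_def by (intro exI[of _ E]) auto
    next
      case False
      have "Sup S \<le> t" by (intro Sup_least S_le)
      \<comment> \<open>An infinite supremum would not exceed its own half, so the finiteness of
        \<open>t\<close> matters.\<close>
      then have fin: "Sup S < top"
        using \<open>t \<noteq> \<infinity>\<close> by (metis infinity_ennreal_def less_top order_le_less_trans)
      have "Sup S / 2 < Sup S"
        using False fin by (cases "Sup S") (auto simp: ennreal_divide_numeral ennreal_less_iff)
      then obtain G where G: "G \<in> sets M" "G \<inter> E = {}" "emeasure M E + emeasure M G \<le> t"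
        "Sup S / 2 < emeasure M G"
        unfolding less_Sup_iff by (auto simp: S_def)
      have Gle: "Sup S \<le> 2 * emeasure M G"
      proof -
        have "Sup S = 2 * (Sup S / 2)"
        proof (cases "Sup S")
          case (real r)
          have "2 * (ennreal r / 2) = ennreal 2 * ennreal (r / 2)"
            using real by (simp add: ennreal_divide_numeral)
          also have "\<dots> = ennreal (2 * (r / 2))"
            using real by (intro ennreal_mult[symmetric]) auto
          finally show ?thesis using real by simp
        qed (use fin in \<open>simp del: Sup_eq_top_iff\<close>)
        also have "\<dots> \<le> 2 * emeasure M G" using G(4) by (intro mult_left_mono) auto
        finally show ?thesis .
      qed
      have "(E \<union> G) - E = G" using G(2) by auto
      moreover have "emeasure M (E \<union> G) = emeasure M E + emeasure M G"
        using G E unfolding P_def by (subst plus_emeasure) auto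
      ultimately show ?thesis using E G Gle upper unfolding P_def Q_def
        by (intro exI[of _ "E \<union> G"]) (auto intro: order_trans)
    qed
  qed
  have "\<exists>f. \<forall>n. P (f n) \<and> Q (f n) (f (Suc n))"
    by (rule dependent_nat_choice[where P = "\<lambda>_. P" and Q = "\<lambda>_. Q"])
      (use step in \<open>auto simp: P_def intro: exI[of _ "{}"]\<close>)
  then obtain f where f: "\<And>n. P (f n)" "\<And>n. Q (f n) (f (Suc n))" by auto
  have sets[measurable]: "f n \<in> sets M" for n using f(1) unfolding P_def by auto
  have "incseq f" using f(2) unfolding Q_def by (intro incseq_SucI) auto
  then have "emeasure M (\<Union>n. f n) = (SUP n. emeasure M (f n))"
    by (intro SUP_emeasure_incseq[symmetric]) auto
  then have le: "emeasure M (\<Union>n. f n) \<le> t"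
    using f(1) unfolding P_def by (auto intro!: SUP_least)
  have "\<not> emeasure M (\<Union>n. f n) < t"
  proof
    assume less: "emeasure M (\<Union>n. f n) < t"
    define U where "U = (\<Union>n. f n)"
    have U: "U \<in> sets M" "emeasure M U < t" using less by (auto simp: U_def)
    have "emeasure M (space M - U) \<noteq> 0"
    proof
      assume "emeasure M (space M - U) = 0"
      moreover have "emeasure M (space M) = emeasure M U + emeasure M (space M - U)"
        using U sets.sets_into_space[OF U(1)]
        by (subst plus_emeasure) (auto simp: Un_absorb1)
      ultimately show False using U(2) assms(2) by simp
    qed
    \<comment> \<open>A set \<open>G\<close> that fits beside the union \<open>U\<close> also fits
      at every earlier stage, so each stage adds at least half the measure of \<open>G\<close>. The
      increments are disjoint and stay below the finite \<open>t\<close>, a contradiction.\<close>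
    then obtain G where G: "G \<in> sets M" "G \<subseteq> space M - U" "0 < emeasure M G"
      "emeasure M G < t - emeasure M U"
      using non_atomic_obtain_small[OF assms(1), of "space M - U" "t - emeasure M U"] U
      by (metis diff_gr0_ennreal not_gr_zero sets.compl_sets)
    have "emeasure M (f n) + emeasure M G \<le> t" for n
    proof -
      have "emeasure M (f n) + emeasure M G \<le> emeasure M U + (t - emeasure M U)"
        using U G by (intro add_mono emeasure_mono) (auto simp: U_def)
      also have "\<dots> = t" using U(2) by (intro add_diff_inverse_ennreal) auto
      finally show ?thesis .
    qed
    moreover have "G \<inter> f n = {}" for n using G(2) by (auto simp: U_def)
    ultimately have Gle: "emeasure M G \<le> 2 * emeasure M (f (Suc n) - f n)" for n
      using f(2)[of n] G(1) unfolding Q_def by auto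
    have mult: "of_nat n * emeasure M G \<le> 2 * emeasure M (f n)" for n
    proof (induction n)
      case (Suc n)
      have "of_nat (Suc n) * emeasure M G \<le> 2 * emeasure M (f n) + 2 * emeasure M (f (Suc n) - f n)"
        using add_mono[OF Suc Gle[of n]] by (simp add: distrib_right add.commute)
      also have "\<dots> = 2 * emeasure M (f (Suc n))"
        using \<open>incseq f\<close>[THEN incseq_SucD, of n]
        by (simp add: distrib_left[symmetric] plus_emeasure Un_absorb1)
      finally show ?case .
    qed simp
    have bound: "of_nat n * emeasure M G \<le> 2 * t" for n
      using mult[of n] f(1)[of n] unfolding P_def by (meson mult_left_mono order_trans zero_le)
    obtain g where g: "emeasure M G = ennreal g" "0 < g"
      using G(3,4) by (cases "emeasure M G") (auto simp: ennreal_zero_less_mult_iff)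
    obtain r where r: "t = ennreal r" "0 \<le> r" using False by (cases t) auto
    obtain n :: nat where "2 * r / g < real n" using reals_Archimedean2 by blast
    then have "2 * r < real n * g" using g(2) by (simp add: field_simps)
    moreover have "ennreal (real n * g) \<le> ennreal (2 * r)"
      using bound[of n] g r by (simp add: ennreal_mult' ennreal_of_nat_eq_real_of_nat)
    ultimately show False using r by (simp add: ennreal_le_iff)
  qed
  with le show thesis by (intro that[of "\<Union>n. f n"]) auto
qed

section \<open>Rearrangements of characteristic functions\<close>

lemma rearr_antimono: "antimono (rearr M f)"
  unfolding rearr_def
  by (intro antimonoI Inf_superset_mono) (blast intro: order_trans ennreal_leI)

lemma borel_measurable_monotone_real:
  fixes g :: "real \<Rightarrow> 'b::{second_countable_topology, linorder_topology}"
  assumes "mono g \<or> antimono g"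
  shows "g \<in> borel_measurable borel"
proof (rule borel_measurableI_greater)
  fix c
  have "is_interval {x. c < g x}"
    using assms unfolding is_interval_1 by (auto intro: less_le_trans dest: monoD antimonoD)
  then show "{x \<in> space borel. c < g x} \<in> sets borel"
    by (simp add: real_interval_borel_measurable)
qed

lemma borel_measurable_rearr [measurable]: "rearr M f \<in> borel_measurable borel"
  using rearr_antimono by (intro borel_measurable_monotone_real) blast

lemma rearr_char_fun:
  assumes "E \<in> sets M"
  shows "rearr M (char_fun E) t = (if ennreal t < emeasure M E then 1 else 0)"
proof -
  have "{x \<in> space M. emod (char_fun E x) > ennreal s} = (if s < 1 then E else {})" if "0 \<le> s" for s
    using assms that sets.sets_into_space[OF assms]
    by (auto simp: char_fun_def ennreal_less_iff simp flip: ennreal_1)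
  then have "{ennreal s |s. 0 \<le> s \<and> emeasure M {x \<in> space M. emod (char_fun E x) > ennreal s} \<le> ennreal t}
     = {ennreal s |s. 0 \<le> s \<and> (s < 1 \<longrightarrow> emeasure M E \<le> ennreal t)}"
    by (intro Collect_cong ex_cong) auto
  also have "Inf \<dots> = (if ennreal t < emeasure M E then 1 else 0)"
  proof (cases "ennreal t < emeasure M E")
    case True
    then have "{ennreal s |s. 0 \<le> s \<and> (s < 1 \<longrightarrow> emeasure M E \<le> ennreal t)} = {ennreal s |s. 1 \<le> s}"
      by (auto simp: not_le)
    also have "Inf \<dots> = 1"
      by (intro antisym Inf_greatest Inf_lower) (auto simp flip: ennreal_1 intro!: exI[of _ 1] ennreal_leI)
    finally show ?thesis using True by simp
  next
    case False
    have "Inf {ennreal s |s. 0 \<le> s \<and> (s < 1 \<longrightarrow> emeasure M E \<le> ennreal t)} \<le> ennreal 0"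
      using False by (intro Inf_lower) (auto simp: not_less intro!: exI[of _ 0])
    then show ?thesis using False by simp
  qed
  finally show ?thesis unfolding rearr_def .
qed

lemma avg_rearr_char_fun:
  assumes "E \<in> sets M" "0 < t"
  shows "avg_rearr M (char_fun E) t = min 1 (emeasure M E / ennreal t)"
proof -
  have "(\<integral>\<^sup>+ s. rearr M (char_fun E) s \<partial>lebesgue_on {0<..<t}) = min (ennreal t) (emeasure M E)"
  proof (cases "emeasure M E")
    case (real r)
    have "(\<integral>\<^sup>+ s. rearr M (char_fun E) s \<partial>lebesgue_on {0<..<t})
      = (\<integral>\<^sup>+ s. rearr M (char_fun E) s * indicator {0<..<t} s \<partial>lebesgue)"
      by (simp add: nn_integral_restrict_space)
    also have "\<dots> = (\<integral>\<^sup>+ s. indicator {0<..<min t r} s \<partial>lebesgue)"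
      using assms real
      by (intro nn_integral_cong) (auto simp: rearr_char_fun indicator_def ennreal_less_iff)
    also have "\<dots> = min (ennreal t) (emeasure M E)"
      using real \<open>0 < t\<close> by (cases "t \<le> r") (auto simp: min_def ennreal_leI ennreal_le_iff)
    finally show ?thesis .
  next
    case top
    have "(\<integral>\<^sup>+ s. rearr M (char_fun E) s \<partial>lebesgue_on {0<..<t})
      = (\<integral>\<^sup>+ s. indicator {0<..<t} s \<partial>lebesgue)"
      using assms top
      by (subst nn_integral_restrict_space)
        (auto intro!: nn_integral_cong simp: rearr_char_fun split: split_indicator)
    then show ?thesis using \<open>0 < t\<close> top by simp
  qed
  moreover have "ennreal t / ennreal t = 1" using \<open>0 < t\<close> by (simp add: divide_ennreal)
  ultimately show ?thesis
    using divide_right_mono_ennreal[of "ennreal t" "emeasure M E" "ennreal t"]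
      divide_right_mono_ennreal[of "emeasure M E" "ennreal t" "ennreal t"]
    unfolding avg_rearr_def
    by (cases "ennreal t \<le> emeasure M E") (auto simp: min_def)
qed

section \<open>Comparison of integrals of non-increasing functions\<close>

lemma ennreal_le_mult_iff:
  assumes "0 < C"
  shows "x \<le> ennreal C * y \<longleftrightarrow> ennreal (1 / C) * x \<le> y"
proof -
  have inv: "ennreal (1 / C) * ennreal C = 1" "ennreal C * ennreal (1 / C) = 1"
    using assms by (simp_all flip: ennreal_mult)
  show ?thesis
  proof
    assume "x \<le> ennreal C * y"
    then have "ennreal (1 / C) * x \<le> ennreal (1 / C) * (ennreal C * y)" by (rule mult_left_mono) simp
    then show "ennreal (1 / C) * x \<le> y" by (simp add: mult.assoc[symmetric] inv)
  next
    assume "ennreal (1 / C) * x \<le> y"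
    then have "ennreal C * (ennreal (1 / C) * x) \<le> ennreal C * y" by (rule mult_left_mono) simp
    then show "x \<le> ennreal C * y" by (simp add: mult.assoc[symmetric] inv)
  qed
qed

text \<open>The estimates below yield two upper bounds with unrelated constants. The maximum taken
  here secures the order \<open>c \<le> C\<close> that the definition demands, whatever the sign of
  \<open>C'\<close>.\<close>

lemma equiv_onI:
  assumes "0 < C" "\<And>x. x \<in> D \<Longrightarrow> g x \<le> ennreal C * h x" "\<And>x. x \<in> D \<Longrightarrow> h x \<le> ennreal C' * g x"
  shows "equiv_on D g h"
  unfolding equiv_on_def
proof (rule exI[of _ "1 / C"], rule exI[of _ "max (1 / C) C'"], intro conjI ballI)
  fix x assume x: "x \<in> D"
  show "ennreal (1 / C) * g x \<le> h x"
    using assms(1) assms(2)[OF x] by (simp only: ennreal_le_mult_iff)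
  have "h x \<le> ennreal C' * g x" using x by fact
  also have "\<dots> \<le> ennreal (max (1 / C) C') * g x" by (intro mult_right_mono ennreal_leI) auto
  finally show "h x \<le> ennreal (max (1 / C) C') * g x" .
qed (use assms(1) in auto)

lemma equiv_onE:
  assumes "equiv_on D g h"
  obtains C where "0 < C" "\<And>x. x \<in> D \<Longrightarrow> g x \<le> ennreal C * h x" "\<And>x. x \<in> D \<Longrightarrow> h x \<le> ennreal C * g x"
proof -
  obtain c C where c: "0 < c" "c \<le> C" "\<And>x. x \<in> D \<Longrightarrow> ennreal c * g x \<le> h x \<and> h x \<le> ennreal C * g x"
    using assms unfolding equiv_on_def by blast
  define K where "K = max (1 / c) C"
  have "g x \<le> ennreal K * h x" if "x \<in> D" for x
  proof -
    have "g x \<le> ennreal (1 / c) * h x"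
      using c(1) c(3)[OF that] by (subst ennreal_le_mult_iff) auto
    also have "\<dots> \<le> ennreal K * h x" unfolding K_def by (intro mult_right_mono ennreal_leI) auto
    finally show ?thesis .
  qed
  moreover have "h x \<le> ennreal K * g x" if "x \<in> D" for x
  proof -
    have "h x \<le> ennreal C * g x" using c(3)[OF that] by blast
    also have "\<dots> \<le> ennreal K * g x" unfolding K_def by (intro mult_right_mono ennreal_leI) auto
    finally show ?thesis .
  qed
  moreover have "0 < K" using c(1,2) by (simp add: K_def less_max_iff_disj)
  ultimately show thesis by (intro that[of K])
qed

lemma equiv_on_sym: "equiv_on D g h \<Longrightarrow> equiv_on D h g"
  by (erule equiv_onE) (rule equiv_onI)

lemma equiv_on_trans:
  assumes "equiv_on D f g" "equiv_on D g h"
  shows "equiv_on D f h"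
proof -
  obtain C where C: "0 < C" "\<And>x. x \<in> D \<Longrightarrow> f x \<le> ennreal C * g x" "\<And>x. x \<in> D \<Longrightarrow> g x \<le> ennreal C * f x"
    using assms(1) by (rule equiv_onE) (rule that)
  obtain K where K: "0 < K" "\<And>x. x \<in> D \<Longrightarrow> g x \<le> ennreal K * h x" "\<And>x. x \<in> D \<Longrightarrow> h x \<le> ennreal K * g x"
    using assms(2) by (rule equiv_onE) (rule that)
  have mult: "ennreal (C * K) * x = ennreal C * (ennreal K * x)" "ennreal (C * K) * x = ennreal K * (ennreal C * x)" for x
    using C(1) K(1) by (simp_all add: ennreal_mult mult_ac)
  show ?thesis
  proof (rule equiv_onI)
    show "0 < C * K" using C(1) K(1) by simp
    fix x assume x: "x \<in> D"
    show "f x \<le> ennreal (C * K) * h x"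
      unfolding mult(1) by (rule order_trans[OF C(2)[OF x] mult_left_mono[OF K(2)[OF x]]]) simp
    show "h x \<le> ennreal (C * K) * f x"
      unfolding mult(2) by (rule order_trans[OF K(3)[OF x] mult_left_mono[OF C(3)[OF x]]]) simp
  qed
qed

lemma equiv_on_subset: "equiv_on D g h \<Longrightarrow> D' \<subseteq> D \<Longrightarrow> equiv_on D' g h"
  unfolding equiv_on_def by (meson subsetD)

lemma equiv_on_insert_zero:
  assumes "equiv_on {0<..} g h" "g 0 = 0" "h 0 = 0"
  shows "equiv_on {0::real..} g h"
proof -
  have "{0::real..} = insert 0 {0<..}" by auto
  then show ?thesis using assms unfolding equiv_on_def by (simp add: ball_insert)
qed

text \<open>Membership in the spaces is finiteness of a functional, so this turns equivalence of
  functionals into equality of spaces.\<close>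

lemma equiv_on_finite_iff:
  assumes "equiv_on D g h" "x \<in> D"
  shows "g x < \<infinity> \<longleftrightarrow> h x < \<infinity>"
proof -
  obtain C where C: "0 < C" "\<And>x. x \<in> D \<Longrightarrow> g x \<le> ennreal C * h x" "\<And>x. x \<in> D \<Longrightarrow> h x \<le> ennreal C * g x"
    using assms(1) by (rule equiv_onE) (rule that)
  have fin: "ennreal C * y < \<infinity>" if "y < \<infinity>" for y
    using that by (simp add: ennreal_mult_less_top)
  show ?thesis
    using order_le_less_trans[OF C(2)[OF assms(2)] fin] order_le_less_trans[OF C(3)[OF assms(2)] fin]
    by blast
qed

text \<open>Superlevel sets of a non-increasing function are initial segments of the half line, so by the
  layer cake formula two measures need only be compared on the intervals \<open>[0, d]\<close>.\<close>

lemma initial_segment_sequence: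
  fixes S :: "real set"
  assumes "S \<subseteq> {0..}" "\<forall>x\<in>S. {0..x} \<subseteq> S"
  obtains e :: "nat \<Rightarrow> real" where "incseq e" "S = (\<Union>n. {0..e n})"
proof -
  have down: "y \<in> S" if "x \<in> S" "0 \<le> y" "y \<le> x" for x y
    using bspec[OF assms(2) that(1)] that(2,3) by auto
  consider "S = {}" | "S \<noteq> {}" "\<not> bdd_above S" | "S \<noteq> {}" "bdd_above S" "Sup S \<in> S"
    | "S \<noteq> {}" "bdd_above S" "Sup S \<notin> S"
    by argo
  then show thesis
  proof cases
    case 1
    \<comment> \<open>A negative right endpoint makes every interval empty.\<close>
    then show ?thesis by (intro that[of "\<lambda>_. -1"]) auto
  next
    case 2
    have "S = (\<Union>n::nat. {0..real n})"
    proof (intro equalityI subsetI)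
      fix x assume "x \<in> S"
      then show "x \<in> (\<Union>n::nat. {0..real n})"
        using assms(1) real_arch_simple[of x] by auto
    next
      fix x assume "x \<in> (\<Union>n::nat. {0..real n})"
      then have "0 \<le> x" by auto
      moreover obtain y where "y \<in> S" "x < y"
        using 2 by (meson bdd_above.I not_le)
      ultimately show "x \<in> S" using down by auto
    qed
    then show ?thesis by (intro that[of real]) (auto simp: incseq_def)
  next
    case 3
    have "S = {0..Sup S}"
      using assms(1) down[OF 3(3)] cSup_upper[OF _ 3(2)] by auto
    then show ?thesis by (intro that[of "\<lambda>_. Sup S"]) auto
  next
    case 4
    \<comment> \<open>The supremum is not attained, so the endpoints have to approach it strictly
      from below.\<close>
    have "S = (\<Union>n. {0..Sup S - 1 / Suc n})"
    proof (intro equalityI subsetI)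
      fix x assume x: "x \<in> S"
      then have "x < Sup S" using 4 cSup_upper[OF x] by (metis order_le_less)
      then obtain n where "1 / Suc n < Sup S - x"
        by (metis diff_gt_0_iff_gt inverse_eq_divide reals_Archimedean)
      then show "x \<in> (\<Union>n. {0..Sup S - 1 / Suc n})" using x assms(1) by (auto intro!: exI[of _ n])
    next
      fix x assume "x \<in> (\<Union>n. {0..Sup S - 1 / Suc n})"
      then obtain n :: nat where "0 \<le> x" "x \<le> Sup S - 1 / Suc n" by auto
      moreover have "0 < 1 / real (Suc n)" by simp
      ultimately have "0 \<le> x" "x < Sup S" by linarith+
      then show "x \<in> S" using 4 down less_cSup_iff[of S x] by (meson less_imp_le)
    qed
    then show ?thesis
      by (intro that[of "\<lambda>n. Sup S - 1 / Suc n"]) (auto simp: incseq_def frac_le)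
  qed
qed

text \<open>Continuity from below carries the bound over to increasing unions. Intervals with a
  negative endpoint are empty, so bounds for \<open>0 \<le> d\<close> cover the whole
  sequence.\<close>

lemma emeasure_initial_segment_le:
  fixes \<mu> \<nu> :: "real measure"
  assumes "sets \<mu> = sets borel" "sets \<nu> = sets borel"
    and le: "\<And>d. 0 \<le> d \<Longrightarrow> emeasure \<mu> {0..d} \<le> ennreal C * emeasure \<nu> {0..d}"
    and S: "S \<subseteq> {0..}" "\<forall>x\<in>S. {0..x} \<subseteq> S"
  shows "emeasure \<mu> S \<le> ennreal C * emeasure \<nu> S"
proof -
  obtain e :: "nat \<Rightarrow> real" where e: "incseq e" "S = (\<Union>n. {0..e n})"
    by (rule initial_segment_sequence[OF S]) (rule that)
  have inc: "incseq (\<lambda>n. {0..e n})" using incseqD[OF e(1)] by (force simp: incseq_def)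
  have "emeasure \<mu> S = (SUP n. emeasure \<mu> {0..e n})"
    unfolding e(2) using inc assms by (intro SUP_emeasure_incseq[symmetric]) auto
  also have "\<dots> \<le> ennreal C * emeasure \<nu> S"
  proof (rule SUP_least)
    fix n
    have "emeasure \<mu> {0..e n} \<le> ennreal C * emeasure \<nu> {0..e n}"
      using le[of "e n"] by (cases "0 \<le> e n") auto
    also have "\<dots> \<le> ennreal C * emeasure \<nu> S"
      using assms by (intro mult_left_mono emeasure_mono) (auto simp: e(2))
    finally show "emeasure \<mu> {0..e n} \<le> ennreal C * emeasure \<nu> S" .
  qed
  finally show ?thesis .
qed

text \<open>Fubini for the indicator \<open>P\<close> of the region below the graph: a section at
  fixed \<open>x\<close> has Lebesgue measure \<open>g x\<close>, also when this is infinite, and a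
  section at fixed \<open>l\<close> is a superlevel set.\<close>

lemma nn_integral_layer_cake:
  fixes g :: "real \<Rightarrow> ennreal"
  assumes "sigma_finite_measure \<mu>" and sets[measurable_cong]: "sets \<mu> = sets borel"
    and [measurable]: "g \<in> borel_measurable borel"
  shows "(\<integral>\<^sup>+ x\<in>{0..}. g x \<partial>\<mu>) = (\<integral>\<^sup>+ l\<in>{0<..}. emeasure \<mu> {x. 0 \<le> x \<and> ennreal l < g x} \<partial>lborel)"
proof -
  interpret \<mu>: sigma_finite_measure \<mu> by fact
  interpret pair_sigma_finite \<mu> lborel
    by (intro pair_sigma_finite.intro assms(1) lborel.sigma_finite_measure_axioms)
  have space: "space \<mu> = UNIV" using sets_eq_imp_space_eq[OF sets] by simp
  define P where "P = (\<lambda>(x, l). if 0 \<le> x \<and> 0 < l \<and> ennreal l < g x then 1 else 0 :: ennreal)"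
  have P[measurable]: "P \<in> borel_measurable (\<mu> \<Otimes>\<^sub>M lborel)"
    unfolding P_def by measurable
  have inner: "g x * indicator {0..} x = (\<integral>\<^sup>+ l. P (x, l) \<partial>lborel)" for x
  proof (cases "0 \<le> x")
    case True
    have "(\<integral>\<^sup>+ l. P (x, l) \<partial>lborel) = (\<integral>\<^sup>+ l. indicator {l. 0 < l \<and> ennreal l < g x} l \<partial>lborel)"
      using True by (intro nn_integral_cong) (auto simp: P_def)
    also have "\<dots> = emeasure lborel {l. 0 < l \<and> ennreal l < g x}"
      by (intro nn_integral_indicator) measurable
    also have "\<dots> = g x"
    proof (cases "g x")
      case (real r)
      then have "{l. 0 < l \<and> ennreal l < g x} = {0<..<r}" by (auto simp: ennreal_less_iff)
      then show ?thesis using real by simp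
    next
      case top
      then have "{l. 0 < l \<and> ennreal l < g x} = {0<..}" by auto
      moreover have "emeasure lborel {0::real<..} = top"
      proof (rule ccontr)
        assume "emeasure lborel {0::real<..} \<noteq> top"
        then obtain r where r: "emeasure lborel {0::real<..} = ennreal r" "0 \<le> r"
          by (cases "emeasure lborel {0::real<..}") auto
        have "emeasure lborel {0<..<r + 1} \<le> emeasure lborel {0::real<..}"
          by (intro emeasure_mono) auto
        then show False using r by (simp add: ennreal_le_iff)
      qed
      ultimately show ?thesis using top by simp
    qed
    finally show ?thesis using True by simp
  qed (simp add: P_def)
  have outer: "(\<integral>\<^sup>+ x. P (x, l) \<partial>\<mu>) = emeasure \<mu> {x. 0 \<le> x \<and> ennreal l < g x} * indicator {0<..} l" for l
  proof (cases "0 < l")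
    case True
    have "{x. 0 \<le> x \<and> ennreal l < g x} = {x \<in> space \<mu>. 0 \<le> x \<and> ennreal l < g x}"
      by (simp add: space)
    also have "\<dots> \<in> sets \<mu>" by measurable
    finally have "{x. 0 \<le> x \<and> ennreal l < g x} \<in> sets \<mu>" .
    then have "(\<integral>\<^sup>+ x. indicator {x. 0 \<le> x \<and> ennreal l < g x} x \<partial>\<mu>) = emeasure \<mu> {x. 0 \<le> x \<and> ennreal l < g x}"
      by (rule nn_integral_indicator)
    moreover have "(\<integral>\<^sup>+ x. P (x, l) \<partial>\<mu>) = (\<integral>\<^sup>+ x. indicator {x. 0 \<le> x \<and> ennreal l < g x} x \<partial>\<mu>)"
      using True by (intro nn_integral_cong) (auto simp: P_def)
    ultimately show ?thesis using True by simp
  qed (simp add: P_def)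
  show ?thesis unfolding inner outer[symmetric] by (rule Fubini'[symmetric]) (simp add: case_prod_unfold)
qed

text \<open>Each superlevel set of \<open>g\<close> in the half line is an initial segment, so the
  two measures are compared level by level and the inequality is then integrated over the
  levels.\<close>

lemma nn_integral_antimono_le:
  fixes g :: "real \<Rightarrow> ennreal"
  assumes "antimono g"
    and "sigma_finite_measure \<mu>" "sets \<mu> = sets borel"
    and "sigma_finite_measure \<nu>" "sets \<nu> = sets borel"
    and "\<And>d. 0 \<le> d \<Longrightarrow> emeasure \<mu> {0..d} \<le> ennreal C * emeasure \<nu> {0..d}"
  shows "(\<integral>\<^sup>+ x\<in>{0..}. g x \<partial>\<mu>) \<le> ennreal C * (\<integral>\<^sup>+ x\<in>{0..}. g x \<partial>\<nu>)"
proof -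
  have meas[measurable]: "g \<in> borel_measurable borel"
    using assms(1) by (intro borel_measurable_monotone_real) blast
  \<comment> \<open>Monotonicity in the level supplies the measurability needed to pull the constant
    out of the integral over \<open>l\<close>.\<close>
  have "antimono (\<lambda>l. emeasure \<nu> {x. 0 \<le> x \<and> ennreal l < g x})"
  proof (intro antimonoI emeasure_mono)
    fix l show "{x. 0 \<le> x \<and> ennreal l < g x} \<in> sets \<nu>"
      unfolding assms(5) by measurable
  qed (auto intro: order_le_less_trans ennreal_leI)
  then have [measurable]: "(\<lambda>l. emeasure \<nu> {x. 0 \<le> x \<and> ennreal l < g x}) \<in> borel_measurable borel"
    by (intro borel_measurable_monotone_real) blast
  have "(\<integral>\<^sup>+ l\<in>{0<..}. emeasure \<mu> {x. 0 \<le> x \<and> ennreal l < g x} \<partial>lborel)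
      \<le> (\<integral>\<^sup>+ l. ennreal C * (emeasure \<nu> {x. 0 \<le> x \<and> ennreal l < g x} * indicator {0<..} l) \<partial>lborel)"
  proof (intro nn_integral_mono)
    fix l :: real
    have "emeasure \<mu> {x. 0 \<le> x \<and> ennreal l < g x} \<le> ennreal C * emeasure \<nu> {x. 0 \<le> x \<and> ennreal l < g x}"
      using assms(3,5,6)
      by (rule emeasure_initial_segment_le) (auto elim: order_less_le_trans[OF _ antimonoD[OF assms(1)]])
    then show "emeasure \<mu> {x. 0 \<le> x \<and> ennreal l < g x} * indicator {0<..} l
        \<le> ennreal C * (emeasure \<nu> {x. 0 \<le> x \<and> ennreal l < g x} * indicator {0<..} l)"
      by (auto split: split_indicator)
  qed
  also have "\<dots> = ennreal C * (\<integral>\<^sup>+ l\<in>{0<..}. emeasure \<nu> {x. 0 \<le> x \<and> ennreal l < g x} \<partial>lborel)"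
    by (intro nn_integral_cmult) measurable
  finally show ?thesis
    unfolding nn_integral_layer_cake[OF assms(2,3) meas] nn_integral_layer_cake[OF assms(4,5) meas] .
qed

section \<open>Stieltjes measures of concave functions\<close>

text \<open>A concave function is continuous on the open half line, and the limit condition at 0
  rules out an atom there. The right limits in \<open>stieltjes_measure\<close> therefore give back
  the function itself.\<close>

lemma
  assumes "mono_on {0..} \<psi>" "concave_on {0..} \<psi>" "\<psi> 0 = 0" "(\<psi> \<longlongrightarrow> 0) (at_right 0)"
  shows sigma_finite_stieltjes_measure: "sigma_finite_measure (stieltjes_measure \<psi>)"
    and sets_stieltjes_measure: "sets (stieltjes_measure \<psi>) = sets borel"
    and emeasure_stieltjes_measure: "0 \<le> d \<Longrightarrow> emeasure (stieltjes_measure \<psi>) {0..d} = ennreal (\<psi> d)"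
proof -
  \<comment> \<open>The extension by \<open>\<psi> 0 = 0\<close> to the negative reals; it is
    continuous everywhere and is the distribution function of the measure.\<close>
  define F where "F t = \<psi> (max 0 t)" for t
  have "convex_on {0<..} (\<lambda>t. - \<psi> t)"
    using assms(2) unfolding concave_on_def by (rule convex_on_subset) auto
  then have "continuous_on {0<..} (\<lambda>t. - \<psi> t)"
    by (intro convex_on_continuous) auto
  from continuous_on_minus[OF this] have cont: "isCont \<psi> t" if "0 < t" for t
    using that by (simp add: continuous_on_eq_continuous_at)
  have "continuous (at t within {0..}) \<psi>" if "0 \<le> t" for t
  proof (cases "t = 0")
    case True
    then show ?thesis using assms(3,4) by (simp add: continuous_within at_within_Ici_at_right)
  next
    case False
    then show ?thesis using that by (intro continuous_at_imp_continuous_at_within[OF cont]) simp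
  qed
  then have "continuous_on {0..} \<psi>" by (simp add: continuous_on_eq_continuous_within)
  then have contF: "continuous_on UNIV F"
    unfolding F_def by (rule continuous_on_compose2) (auto intro!: continuous_intros)
  have monoF: "F x \<le> F y" if "x \<le> y" for x y
    unfolding F_def using that by (intro mono_onD[OF assms(1)]) auto
  have "(if t < 0 then 0 else Lim (at_right t) \<psi>) = F t" for t
  proof (cases "0 < t")
    case True
    have "(\<psi> \<longlongrightarrow> \<psi> t) (at_right t)"
      by (rule tendsto_within_subset[OF cont[OF True, unfolded isCont_def]]) simp
    then have "Lim (at_right t) \<psi> = \<psi> t" by (intro tendsto_Lim) auto
    then show ?thesis using True by (simp add: F_def)
  next
    case False
    have "Lim (at_right 0) \<psi> = 0" using assms(4) by (intro tendsto_Lim) auto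
    then show ?thesis using False assms(3) by (auto simp: F_def max_def)
  qed
  then have eq: "stieltjes_measure \<psi> = interval_measure F" by (simp add: stieltjes_measure_def)
  have right: "continuous (at_right t) F" for t
    by (rule continuous_at_imp_continuous_at_within) (use contF in \<open>simp add: continuous_on_eq_continuous_at\<close>)
  show "sigma_finite_measure (stieltjes_measure \<psi>)"
    unfolding eq using monoF right by (rule sigma_finite_interval_measure)
  show "sets (stieltjes_measure \<psi>) = sets borel" by (simp add: eq)
  show "emeasure (stieltjes_measure \<psi>) {0..d} = ennreal (\<psi> d)" if "0 \<le> d"
    using emeasure_interval_measure_Icc[OF that monoF contF] that assms(3) by (simp add: eq F_def)
qed

section \<open>The norm of \<open>L\<^sup>q(dt/t)\<close>\<close>

lemma borel_measurable_lebesgue_on: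
  "f \<in> borel_measurable borel \<Longrightarrow> f \<in> borel_measurable (lebesgue_on S)"
  by (intro measurable_restrict_space1 measurable_completion) simp

text \<open>An interval of positive length is not contained in a null set. This extracts an actual
  point from a bound by an essential supremum.\<close>

lemma AE_lebesgue_on_obtain:
  fixes x y :: real
  assumes "AE t in lebesgue_on {0<..}. P t" "0 \<le> x" "x < y"
  obtains t where "x < t" "t < y" "P t"
proof -
  have "AE t in lebesgue. 0 < t \<longrightarrow> P t"
    using assms(1) by (subst (asm) AE_restrict_space_iff) auto
  then obtain N where N: "{t. \<not> (0 < t \<longrightarrow> P t)} \<subseteq> N" "emeasure lebesgue N = 0" "N \<in> sets lebesgue"
    by (auto elim!: AE_E)
  have "\<not> {x<..<y} \<subseteq> N"
  proof
    assume "{x<..<y} \<subseteq> N"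
    then have "emeasure lebesgue {x<..<y} \<le> emeasure lebesgue N" using N by (intro emeasure_mono)
    then show False using N(2) \<open>x < y\<close> by simp
  qed
  then show thesis using that N(1) \<open>0 \<le> x\<close> by fastforce
qed

lemma ennreal_powr_ennreal: "0 \<le> x \<Longrightarrow> ennreal_powr (ennreal x) p = ennreal (x powr p)"
  by (simp add: ennreal_powr_def)

lemma ennreal_powr_mono: "x \<le> y \<Longrightarrow> 0 \<le> p \<Longrightarrow> ennreal_powr x p \<le> ennreal_powr y p"
  by (cases x; cases y) (auto simp: ennreal_powr_def top_unique ennreal_le_iff intro!: ennreal_leI powr_mono2)

lemma ennreal_powr_mult:
  assumes "0 < c"
  shows "ennreal_powr (ennreal c * x) p = ennreal (c powr p) * ennreal_powr x p"
proof (cases x)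
  case (real r)
  then show ?thesis using assms
    by (simp add: ennreal_powr_ennreal powr_mult flip: ennreal_mult)
next
  case top
  then show ?thesis using assms by (simp add: ennreal_powr_def ennreal_mult_top)
qed

lemma ennreal_powr_1: "ennreal_powr x 1 = x"
  by (cases x) (auto simp: ennreal_powr_def)

lemma recip_top: "recip top = 0" and recip_1: "recip 1 = 1"
  by (simp_all add: recip_def)

lemma recip_finite:
  assumes "0 < q" "q \<noteq> top"
  shows "0 < enn2real q" "recip q = 1 / enn2real q"
proof -
  obtain r where r: "q = ennreal r" "0 < r"
    using assms by (cases q) (auto simp: ennreal_zero_less_mult_iff)
  then show "0 < enn2real q" by simp
  show "recip q = 1 / enn2real q"
    using r by (simp add: recip_def divide_ennreal flip: ennreal_1)
qed

text \<open>The \<open>L\<^sup>q\<close> norm with respect to \<open>dt / t\<close>; every functional of the theorem that involves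
  \<open>q\<close> is of this form.\<close>

definition log_norm :: "ennreal \<Rightarrow> (real \<Rightarrow> real) \<Rightarrow> ennreal" where
  "log_norm q g = Lq_norm q (\<lambda>t. ennreal (t powr (- recip q) * g t))"

text \<open>The power \<open>t powr (- recip q)\<close>, raised to the exponent \<open>q\<close>, is
  the density 1/t.\<close>

lemma log_norm_finite:
  assumes "0 < q" "q \<noteq> top" "\<And>t. 0 < t \<Longrightarrow> 0 \<le> g t"
  shows "log_norm q g = ennreal_powr
    (\<integral>\<^sup>+ t. ennreal (inverse t * g t powr enn2real q) \<partial>lebesgue_on {0<..}) (1 / enn2real q)"
proof -
  have "(\<integral>\<^sup>+ t. ennreal_powr (ennreal (t powr (- recip q) * g t)) (enn2real q) \<partial>lebesgue_on {0<..})
    = (\<integral>\<^sup>+ t. ennreal (inverse t * g t powr enn2real q) \<partial>lebesgue_on {0<..})"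
  proof (intro nn_integral_cong)
    fix t :: real assume "t \<in> space (lebesgue_on {0<..})"
    then have t: "0 < t" by simp
    have "(t powr (- recip q) * g t) powr enn2real q = inverse t * g t powr enn2real q"
      using t assms recip_finite[OF assms(1,2)]
      by (simp add: powr_mult powr_powr powr_minus[of t 1] divide_inverse mult.commute)
    then show "ennreal_powr (ennreal (t powr (- recip q) * g t)) (enn2real q)
      = ennreal (inverse t * g t powr enn2real q)"
      using assms(3)[OF t] by (simp add: ennreal_powr_ennreal)
  qed
  then show ?thesis using assms(2) by (simp add: log_norm_def Lq_norm_def)
qed

lemma log_norm_top:
  assumes [measurable]: "g \<in> borel_measurable (lebesgue_on {0<..})"
  shows "log_norm top g = esssup (lebesgue_on {0<..}) (\<lambda>t. ennreal (g t))"
  unfolding log_norm_def Lq_norm_def recip_top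
  \<comment> \<open>For infinite \<open>q\<close> the factor is \<open>t powr 0\<close>, which is 0
    at \<open>t = 0\<close> and 1 at all other points; hence the conditional function.\<close>
  by (auto intro!: esssup_AE_cong borel_measurable_times measurable_compose[OF _ measurable_ennreal]
      borel_measurable_lebesgue_on[of "\<lambda>t. if t = 0 then 0 else 1"])

lemma ident_measurable_lebesgue_on [measurable]: "(\<lambda>t. t) \<in> borel_measurable (lebesgue_on S)"
  by (rule borel_measurable_lebesgue_on) simp

context
  fixes q :: ennreal
  assumes q: "0 < q"
begin

lemma log_norm_mono:
  assumes [measurable]: "g \<in> borel_measurable (lebesgue_on {0<..})"
    "h \<in> borel_measurable (lebesgue_on {0<..})"
    and le: "\<And>t. 0 < t \<Longrightarrow> 0 \<le> g t" "\<And>t. 0 < t \<Longrightarrow> g t \<le> h t"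
  shows "log_norm q g \<le> log_norm q h"
proof (cases "q = top")
  case True
  then show ?thesis using le
    by (auto simp: log_norm_top intro!: esssup_AE_mono AE_I2 ennreal_leI)
next
  case False
  have "0 \<le> h t" if "0 < t" for t using le[OF that] by simp
  then show ?thesis using recip_finite[OF q False] le
    by (subst log_norm_finite[OF q False, of g], simp, subst log_norm_finite[OF q False, of h])
      (auto intro!: ennreal_powr_mono nn_integral_mono ennreal_leI mult_left_mono powr_mono2)
qed

lemma log_norm_cmult_le:
  assumes [measurable]: "g \<in> borel_measurable (lebesgue_on {0<..})"
    and nonneg: "\<And>t. 0 < t \<Longrightarrow> 0 \<le> g t" and "0 < c"
  shows "log_norm q (\<lambda>t. c * g t) \<le> ennreal c * log_norm q g"
proof (cases "q = top")
  case True
  have "AE t in lebesgue_on {0<..}. ennreal (c * g t)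
      \<le> ennreal c * esssup (lebesgue_on {0<..}) (\<lambda>t. ennreal (g t))"
    using esssup_AE[of "\<lambda>t. ennreal (g t)" "lebesgue_on {0<..}"]
    by eventually_elim (use \<open>0 < c\<close> in \<open>auto simp: ennreal_mult' intro!: mult_left_mono\<close>)
  then show ?thesis using True by (auto simp: log_norm_top intro!: esssup_I)
next
  case False
  let ?p = "enn2real q"
  have "(\<integral>\<^sup>+ t. ennreal (inverse t * (c * g t) powr ?p) \<partial>lebesgue_on {0<..})
      = (\<integral>\<^sup>+ t. ennreal (c powr ?p) * ennreal (inverse t * g t powr ?p) \<partial>lebesgue_on {0<..})"
    using nonneg \<open>0 < c\<close>
    by (intro nn_integral_cong) (simp add: powr_mult mult_ac flip: ennreal_mult')
  also have "\<dots> = ennreal (c powr ?p) * (\<integral>\<^sup>+ t. ennreal (inverse t * g t powr ?p) \<partial>lebesgue_on {0<..})"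
    by (intro nn_integral_cmult) measurable
  finally show ?thesis
    using nonneg recip_finite[OF q False] \<open>0 < c\<close>
    by (simp add: log_norm_finite[OF q False] ennreal_powr_mult powr_powr)
qed

text \<open>The one-sided bound is applied to \<open>c\<close> and then to
  \<open>inverse c\<close>.\<close>

lemma log_norm_cmult:
  assumes g[measurable]: "g \<in> borel_measurable (lebesgue_on {0<..})"
    and nonneg: "\<And>t. 0 < t \<Longrightarrow> 0 \<le> g t" and "0 < c"
  shows "log_norm q (\<lambda>t. c * g t) = ennreal c * log_norm q g"
proof (rule antisym[OF log_norm_cmult_le[OF assms]])
  have "ennreal c * log_norm q g = ennreal c * log_norm q (\<lambda>t. inverse c * (c * g t))"
    using \<open>0 < c\<close> by (simp add: mult.assoc[symmetric])
  also have "\<dots> \<le> ennreal c * (ennreal (inverse c) * log_norm q (\<lambda>t. c * g t))"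
    using nonneg \<open>0 < c\<close> by (intro mult_left_mono log_norm_cmult_le) auto
  also have "\<dots> = log_norm q (\<lambda>t. c * g t)"
    using \<open>0 < c\<close> by (simp add: mult.assoc[symmetric] flip: ennreal_mult')
  finally show "ennreal c * log_norm q g \<le> log_norm q (\<lambda>t. c * g t)" .
qed

text \<open>Replaces the triangle inequality uniformly in \<open>q\<close>. For finite
  \<open>q\<close> the power of \<open>g\<close> is at most the sum of the powers of
  \<open>h\<close> and \<open>k\<close>; the resulting factor 2 in front of the integral comes out
  of the root as \<open>2 powr recip q\<close>. For infinite \<open>q\<close> that factor is
  1.\<close>

lemma log_norm_max:
  assumes [measurable]: "g \<in> borel_measurable (lebesgue_on {0<..})"
    "h \<in> borel_measurable (lebesgue_on {0<..})" "k \<in> borel_measurable (lebesgue_on {0<..})"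
    and nonneg: "\<And>t. 0 < t \<Longrightarrow> 0 \<le> g t" "\<And>t. 0 < t \<Longrightarrow> 0 \<le> h t" "\<And>t. 0 < t \<Longrightarrow> 0 \<le> k t"
    and le: "\<And>t. 0 < t \<Longrightarrow> g t \<le> h t \<or> g t \<le> k t"
    and x: "log_norm q h \<le> x" "log_norm q k \<le> x"
  shows "log_norm q g \<le> ennreal (2 powr recip q) * x"
proof (cases "q = top")
  case True
  have "AE t in lebesgue_on {0<..}. 0 < t"
    by (intro AE_I2) simp
  then have "AE t in lebesgue_on {0<..}. ennreal (g t) \<le> x"
    using esssup_AE[of "\<lambda>t. ennreal (h t)" "lebesgue_on {0<..}"]
      esssup_AE[of "\<lambda>t. ennreal (k t)" "lebesgue_on {0<..}"]
  proof eventually_elim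
    case (elim t)
    then have "ennreal (h t) \<le> x" "ennreal (k t) \<le> x"
      using x True by (auto simp: log_norm_top)
    then show ?case using le[OF elim(1)] by (meson ennreal_leI order_trans)
  qed
  then show ?thesis using True by (auto simp: log_norm_top recip_top intro!: esssup_I)
next
  case False
  let ?p = "enn2real q" and ?N = "lebesgue_on {0::real<..}"
  note p = recip_finite[OF q False]
  define I where "I u = (\<integral>\<^sup>+ t. ennreal (inverse t * u t powr ?p) \<partial>?N)" for u :: "real \<Rightarrow> real"
  have meas: "(\<lambda>t. ennreal (inverse t * u t powr ?p)) \<in> borel_measurable ?N"
    if "u \<in> borel_measurable ?N" for u :: "real \<Rightarrow> real"
    using that by measurable
  have "I g \<le> (\<integral>\<^sup>+ t. ennreal (inverse t * h t powr ?p) + ennreal (inverse t * k t powr ?p) \<partial>?N)"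
    unfolding I_def
  proof (intro nn_integral_mono)
    fix t :: real assume "t \<in> space ?N"
    then have t: "0 < t" by simp
    have "g t powr ?p \<le> h t powr ?p + k t powr ?p"
    proof -
      have "g t powr ?p \<le> h t powr ?p \<or> g t powr ?p \<le> k t powr ?p"
        using le[OF t] nonneg(1)[OF t] p(1) by (metis less_imp_le powr_mono2)
      then show ?thesis by (smt (verit) powr_ge_zero)
    qed
    then have "inverse t * g t powr ?p \<le> inverse t * h t powr ?p + inverse t * k t powr ?p"
      using t by (simp flip: distrib_left)
    then show "ennreal (inverse t * g t powr ?p)
        \<le> ennreal (inverse t * h t powr ?p) + ennreal (inverse t * k t powr ?p)"
      using t by (simp del: ennreal_plus add: ennreal_plus[symmetric] ennreal_leI)
  qed
  also have "\<dots> = I h + I k" unfolding I_def by (intro nn_integral_add meas) auto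
  also have "\<dots> \<le> 2 * max (I h) (I k)"
    unfolding mult_2 by (intro add_mono) auto
  finally have "ennreal_powr (I g) (1 / ?p) \<le> ennreal_powr (ennreal 2 * max (I h) (I k)) (1 / ?p)"
    using p by (intro ennreal_powr_mono) auto
  also have "\<dots> = ennreal (2 powr recip q) * ennreal_powr (max (I h) (I k)) (1 / ?p)"
    unfolding p(2) by (intro ennreal_powr_mult) simp
  also have "\<dots> \<le> ennreal (2 powr recip q) * x"
    using x nonneg by (intro mult_left_mono)
      (auto simp: log_norm_finite[OF q False] max_def I_def)
  finally show ?thesis using nonneg by (simp add: log_norm_finite[OF q False] I_def)
qed

section \<open>Norms of the model functions\<close>

text \<open>For finite \<open>p = q\<close> the integral of \<open>t powr (p / 2 - 1)\<close> from 0
  to \<open>r\<close> is \<open>2 / p * r powr (p / 2)\<close>. Its \<open>p\<close>-th root gives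
  the constant \<open>(2 / p) powr (1 / p)\<close>.\<close>

lemma log_norm_sqrt_low:
  obtains C where "0 < C"
    "\<And>r. 0 < r \<Longrightarrow> log_norm q (\<lambda>t. sqrt t * indicator {..r} t) \<le> ennreal (C * sqrt r)"
proof (cases "q = top")
  case True
  have "log_norm q (\<lambda>t. sqrt t * indicator {..r} t) \<le> ennreal (1 * sqrt r)" if "0 < r" for r
    using that unfolding True by (subst log_norm_top)
      (auto intro!: esssup_I borel_measurable_lebesgue_on AE_I2 ennreal_leI split: split_indicator)
  then show thesis by (intro that[of 1]) auto
next
  case False
  define p where "p = enn2real q"
  have p: "0 < p" using recip_finite[OF q False] by (simp add: p_def)
  have "log_norm q (\<lambda>t. sqrt t * indicator {..r} t) \<le> ennreal ((2 / p) powr (1 / p) * sqrt r)"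
    if r: "0 < r" for r
  proof -
    have "(\<integral>\<^sup>+ t. ennreal (inverse t * (sqrt t * indicator {..r} t) powr p) \<partial>lebesgue_on {0<..})
        = (\<integral>\<^sup>+ t. ennreal (inverse t * (sqrt t * indicator {..r} t) powr p) * indicator {0<..} t \<partial>lborel)"
      by (simp add: nn_integral_restrict_space nn_integral_completion)
    also have "\<dots> \<le> (\<integral>\<^sup>+ t. ennreal (t powr (p / 2 - 1)) * indicator {0..r} t \<partial>lborel)"
    proof (intro nn_integral_mono)
      fix t :: real
      have "inverse t * sqrt t powr p = t powr (p / 2 - 1)" if "0 < t"
        using that by (simp add: powr_half_sqrt[symmetric] powr_powr powr_diff) (simp add: field_simps)
      then show "ennreal (inverse t * (sqrt t * indicator {..r} t) powr p) * indicator {0<..} t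
          \<le> ennreal (t powr (p / 2 - 1)) * indicator {0..r} t"
        using p by (auto split: split_indicator)
    qed
    also have "\<dots> = ennreal (r powr (p / 2) / (p / 2))"
      using has_integral_powr_from_0[of "p / 2 - 1" r] p r
      by (intro nn_integral_has_integral_lebesgue') auto
    finally have "log_norm q (\<lambda>t. sqrt t * indicator {..r} t)
        \<le> ennreal_powr (ennreal (r powr (p / 2) / (p / 2))) (1 / p)"
      using p unfolding p_def by (subst log_norm_finite[OF q False]) (auto intro!: ennreal_powr_mono)
    also have "\<dots> = ennreal ((2 / p) powr (1 / p) * sqrt r)"
      using p r by (simp add: ennreal_powr_ennreal powr_mult powr_divide powr_powr powr_half_sqrt field_simps)
    finally show ?thesis .
  qed
  then show thesis using p by (intro that[of "(2 / p) powr (1 / p)"]) auto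
qed

text \<open>The mirror image under t -> 1/t, which preserves dt/t; so the constant is the same as
  for the part near 0.\<close>

lemma log_norm_sqrt_high:
  obtains C where "0 < C"
    "\<And>r. 0 < r \<Longrightarrow> log_norm q (\<lambda>t. indicator {r<..} t / sqrt t) \<le> ennreal (C / sqrt r)"
proof (cases "q = top")
  case True
  have "log_norm q (\<lambda>t. indicator {r<..} t / sqrt t) \<le> ennreal (1 / sqrt r)" if "0 < r" for r
    using that unfolding True by (subst log_norm_top)
      (auto intro!: esssup_I borel_measurable_lebesgue_on AE_I2 ennreal_leI divide_left_mono split: split_indicator)
  then show thesis by (intro that[of 1]) auto
next
  case False
  define p where "p = enn2real q"
  have p: "0 < p" using recip_finite[OF q False] by (simp add: p_def)
  have "log_norm q (\<lambda>t. indicator {r<..} t / sqrt t) \<le> ennreal ((2 / p) powr (1 / p) / sqrt r)"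
    if r: "0 < r" for r
  proof -
    have "(\<integral>\<^sup>+ t. ennreal (inverse t * (indicator {r<..} t / sqrt t) powr p) \<partial>lebesgue_on {0<..})
        = (\<integral>\<^sup>+ t. ennreal (inverse t * (indicator {r<..} t / sqrt t) powr p) * indicator {0<..} t \<partial>lborel)"
      by (simp add: nn_integral_restrict_space nn_integral_completion)
    also have "\<dots> \<le> (\<integral>\<^sup>+ t. ennreal (t powr (- (p / 2) - 1)) * indicator {r..} t \<partial>lborel)"
    proof (intro nn_integral_mono)
      fix t :: real
      have "inverse t * (1 / sqrt t) powr p = t powr (- (p / 2) - 1)" if "0 < t"
        using that
        by (simp add: powr_half_sqrt[symmetric] powr_powr powr_diff powr_minus powr_divide)
          (simp add: field_simps)
      then show "ennreal (inverse t * (indicator {r<..} t / sqrt t) powr p) * indicator {0<..} t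
          \<le> ennreal (t powr (- (p / 2) - 1)) * indicator {r..} t"
        using p by (auto split: split_indicator)
    qed
    also have "\<dots> = ennreal (r powr (- (p / 2)) / (p / 2))"
      using has_integral_powr_to_inf[of "- (p / 2) - 1" r] p r
      by (intro nn_integral_has_integral_lebesgue') auto
    finally have "log_norm q (\<lambda>t. indicator {r<..} t / sqrt t)
        \<le> ennreal_powr (ennreal (r powr (- (p / 2)) / (p / 2))) (1 / p)"
      using p unfolding p_def by (subst log_norm_finite[OF q False]) (auto intro!: ennreal_powr_mono)
    also have "\<dots> = ennreal ((2 / p) powr (1 / p) / sqrt r)"
      using p r by (simp add: ennreal_powr_ennreal powr_mult powr_divide powr_powr powr_minus powr_half_sqrt field_simps)
    finally show ?thesis .
  qed
  then show thesis using p by (intro that[of "(2 / p) powr (1 / p)"]) auto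
qed

text \<open>The measure dt/t is invariant under dilations, so all these intervals have the same
  size. Bounding 1/t from below by \<open>1 / (2 * r)\<close> gives at least 1/2 for it, whence the
  constant for finite \<open>q\<close>.\<close>

lemma log_norm_dyadic:
  obtains c where "0 < c" 
    "\<And>r. 0 < r \<Longrightarrow> ennreal c \<le> log_norm q (indicator {r<..<2 * r})"
proof (cases "q = top")
  case True
  have "ennreal 1 \<le> log_norm q (indicator {r<..<2 * r})" if "0 < r" for r :: real
  proof -
    have "AE t in lebesgue_on {0<..}. ennreal (indicator {r<..<2 * r} t) \<le> log_norm top (indicator {r<..<2 * r})"
      by (subst log_norm_top) (auto intro!: borel_measurable_lebesgue_on esssup_AE)
    then obtain t where "r < t" "t < 2 * r"
      "ennreal (indicator {r<..<2 * r} t) \<le> log_norm top (indicator {r<..<2 * r})"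
      using \<open>0 < r\<close> by (elim AE_lebesgue_on_obtain[where x = r and y = "2 * r"]) auto
    then show ?thesis using True by simp
  qed
  then show thesis by (intro that[of 1]) auto
next
  case False
  define p where "p = enn2real q"
  have p: "0 < p" using recip_finite[OF q False] by (simp add: p_def)
  have "ennreal ((1 / 2) powr (1 / p)) \<le> log_norm q (indicator {r<..<2 * r})" if r: "0 < r" for r
  proof -
    have "ennreal (1 / 2) = (\<integral>\<^sup>+ t. ennreal (1 / (2 * r)) * indicator {r<..<2 * r} t \<partial>lborel)"
      using r by (subst nn_integral_cmult_indicator) (auto simp flip: ennreal_mult')
    also have "\<dots> \<le> (\<integral>\<^sup>+ t. ennreal (inverse t * indicator {r<..<2 * r} t powr p) * indicator {0<..} t \<partial>lborel)"
      using r by (intro nn_integral_mono) (auto simp: field_simps split: split_indicator intro!: ennreal_leI)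
    also have "\<dots> = (\<integral>\<^sup>+ t. ennreal (inverse t * indicator {r<..<2 * r} t powr p) \<partial>lebesgue_on {0<..})"
      by (simp add: nn_integral_restrict_space nn_integral_completion)
    finally show ?thesis 
      using p unfolding p_def by (subst log_norm_finite[OF q False])
       (auto simp flip: ennreal_powr_ennreal intro!: ennreal_powr_mono)
  qed
  then show thesis using p by (intro that[of "(1 / 2) powr (1 / p)"]) auto
qed

end

section \<open>Tails of slowly varying weights\<close>

text \<open>The comparison passes through the non-decreasing function equivalent to t^(1/2) b(t);
  \<open>K\<close> is the quotient of the two equivalence constants.\<close>

lemma slowly_varying_sqrt:
  assumes "slowly_varying b"
  obtains K where "0 < K" "\<And>s t. 0 < s \<Longrightarrow> s \<le> t \<Longrightarrow> b s * sqrt s \<le> K * (b t * sqrt t)"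
proof -
  have pos: "0 < b t" if "0 < t" for t using assms that unfolding slowly_varying_def by blast
  obtain u v :: "real \<Rightarrow> real" where u: "\<forall>t>0. 0 \<le> u t \<and> 0 \<le> v t" "mono_on {0<..} u"
    "equiv_on {0<..} (\<lambda>t. ennreal (t powr (1 / 2) * b t)) (\<lambda>t. ennreal (u t))"
    using assms[unfolded slowly_varying_def, THEN conjunct2, THEN conjunct2, rule_format,
        OF half_gt_zero[OF zero_less_one]]
    by (elim exE conjE) (rule that)
  obtain c C where c: "0 < c" "c \<le> C"
    "\<forall>t\<in>{0<..}. ennreal c * ennreal (t powr (1 / 2) * b t) \<le> ennreal (u t)
      \<and> ennreal (u t) \<le> ennreal C * ennreal (t powr (1 / 2) * b t)"
    using u(3)[unfolded equiv_on_def] by (elim exE conjE) (rule that)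
  have lower: "c * (b t * sqrt t) \<le> u t" and upper: "u t \<le> C * (b t * sqrt t)" if "0 < t" for t
  proof -
    have "0 \<le> t powr (1 / 2) * b t" using pos[OF that] by simp
    then have "ennreal (c * (t powr (1 / 2) * b t)) \<le> ennreal (u t)"
      "ennreal (u t) \<le> ennreal (C * (t powr (1 / 2) * b t))"
      using bspec[OF c(3), of t] that c(1,2) by (simp_all add: ennreal_mult)
    then show "c * (b t * sqrt t) \<le> u t" "u t \<le> C * (b t * sqrt t)"
      using u(1) that c(1,2) pos[OF that] by (simp_all add: ennreal_le_iff powr_half_sqrt mult_ac)
  qed
  have "b s * sqrt s \<le> C / c * (b t * sqrt t)" if "0 < s" "s \<le> t" for s t
  proof -
    have "c * (b s * sqrt s) \<le> u s" using that by (intro lower)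
    also have "u s \<le> u t" using that by (intro mono_onD[OF u(2)]) auto
    also have "u t \<le> C * (b t * sqrt t)" using that by (intro upper) auto
    finally show ?thesis using c by (simp add: field_simps)
  qed
  then show thesis using c by (intro that[of "C / c"]) auto
qed

lemma Lq_norm_cong:
  assumes "\<And>t. 0 < t \<Longrightarrow> g t = h t"
  shows "Lq_norm q g = Lq_norm q h"
proof -
  have "(\<integral>\<^sup>+ t. ennreal_powr (g t) (enn2real q) \<partial>lebesgue_on {0<..})
      = (\<integral>\<^sup>+ t. ennreal_powr (h t) (enn2real q) \<partial>lebesgue_on {0<..})"
    using assms by (intro nn_integral_cong) simp
  moreover have "esssup (lebesgue_on {0<..}) g = esssup (lebesgue_on {0<..}) h"
  proof -
    \<comment> \<open>\<open>esssup\<close> takes the default value \<open>top\<close> on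
      non-measurable functions, so both the measurability and the upper limit have to agree.\<close>
    have "g \<in> borel_measurable (lebesgue_on {0<..}) \<longleftrightarrow> h \<in> borel_measurable (lebesgue_on {0<..})"
      using assms by (intro measurable_cong) simp
    moreover have "Limsup (ae_filter (lebesgue_on {0<..})) g = Limsup (ae_filter (lebesgue_on {0<..})) h"
      using assms by (intro Limsup_eq AE_I2) simp
    ultimately show ?thesis by (simp add: esssup_def)
  qed
  ultimately show ?thesis by (simp add: Lq_norm_def)
qed

text \<open>The exponent \<open>\<epsilon> = 1 / 2\<close> is the only instance of slow variation that is used.\<close>

locale sqrt_weight =
  fixes q :: ennreal and b :: "real \<Rightarrow> real" and K :: real
  assumes q: "0 < q"
    and b_meas [measurable]: "b \<in> borel_measurable (lebesgue_on {0<..})"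
    and b_pos: "0 < t \<Longrightarrow> 0 < b t"
    and K_pos: "0 < K"
    and b_sqrt: "0 < s \<Longrightarrow> s \<le> t \<Longrightarrow> b s * sqrt s \<le> K * (b t * sqrt t)"
    and finite_1: "log_norm q (\<lambda>s. b s * indicator {1<..} s) < top"
begin

text \<open>The function a of the theorem, cut off by an indicator inside one norm over the half
  line. This treats all \<open>q\<close> alike, and it is non-increasing on all reals, which later
  gives Borel measurability.\<close>

definition tail :: "real \<Rightarrow> ennreal" where
  "tail t = log_norm q (\<lambda>s. b s * indicator {t<..} s)"

lemma indicator_measurable [measurable]:
  "S \<in> sets borel \<Longrightarrow> (indicator S :: real \<Rightarrow> real) \<in> borel_measurable (lebesgue_on {0<..})"
  by (rule borel_measurable_lebesgue_on) simp

lemma b_nonneg: "0 < t \<Longrightarrow> 0 \<le> b t"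
  using b_pos by (simp add: less_imp_le)

lemma tail_weight_eq:
  assumes "0 < t"
  shows "tail_weight q b t = tail t"
proof (cases "q = top")
  case True
  have "esssup (lebesgue_on {t<..}) (\<lambda>s. ennreal (b s))
      = esssup (lebesgue_on {0<..}) (\<lambda>s. ennreal (b s * indicator {t<..} s))" (is "?l = ?r")
  proof (rule antisym)
    have [measurable]: "b \<in> borel_measurable (lebesgue_on {t<..})"
      using assms by (intro measurable_restrict_mono[OF b_meas]) auto
    have "AE s in lebesgue_on {0<..}. ennreal (b s * indicator {t<..} s) \<le> ?r"
      by (rule esssup_AE)
    then have "AE s in lebesgue_on {t<..}. ennreal (b s) \<le> ?r"
      using assms by (auto simp: AE_restrict_space_iff)
    then show "?l \<le> ?r" by (intro esssup_I) measurable
    have "AE s in lebesgue_on {t<..}. ennreal (b s) \<le> ?l" by (rule esssup_AE)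
    then have "AE s in lebesgue_on {0<..}. ennreal (b s * indicator {t<..} s) \<le> ?l"
      by (auto simp: AE_restrict_space_iff split: split_indicator)
    then show "?r \<le> ?l" by (intro esssup_I) measurable
  qed
  moreover have "tail t = esssup (lebesgue_on {0<..}) (\<lambda>s. ennreal (b s * indicator {t<..} s))"
    unfolding tail_def unfolding True by (rule log_norm_top) measurable
  ultimately show ?thesis by (simp add: tail_weight_def True)
next
  case False
  have "(\<integral>\<^sup>+ s. ennreal (inverse s * b s powr enn2real q) \<partial>lebesgue_on {t<..})
      = (\<integral>\<^sup>+ s. ennreal (inverse s * (b s * indicator {t<..} s) powr enn2real q) \<partial>lebesgue_on {0<..})"
    using assms recip_finite[OF q False]
    by (auto simp: nn_integral_restrict_space intro!: nn_integral_cong split: split_indicator)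
  then show ?thesis using False b_nonneg
    by (simp add: tail_weight_def tail_def log_norm_finite[OF q False])
qed

lemma tail_antimono: "s \<le> t \<Longrightarrow> tail t \<le> tail s"
  unfolding tail_def using b_nonneg
  by (intro log_norm_mono[OF q]) (auto split: split_indicator)

text \<open>For \<open>s\<close> between \<open>t\<close> and \<open>2 * t\<close>, almost
  monotonicity gives \<open>b t \<le> K * sqrt 2 * b s\<close>, and by
  \<open>log_norm_dyadic\<close> that interval alone contributes a fixed amount to the norm.\<close>

lemma weight_le_tail:
  obtains C where "0 < C" "\<And>t. 0 < t \<Longrightarrow> ennreal (b t) \<le> ennreal C * tail t"
proof -
  obtain c where c: "0 < c" "\<And>r. 0 < r \<Longrightarrow> ennreal c \<le> log_norm q (indicator {r<..<2 * r})"
    by (rule log_norm_dyadic[OF q]) (rule that)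
  have "ennreal (b t) \<le> ennreal (K * sqrt 2 / c) * tail t" if t: "0 < t" for t
  proof -
    have le: "b t / (K * sqrt 2) * indicator {t<..<2 * t} s \<le> b s * indicator {t<..} s"
      if s: "0 < s" for s
    proof (cases "t < s \<and> s < 2 * t")
      case True
      have "b t * sqrt t \<le> K * (b s * sqrt s)" using t True by (intro b_sqrt) auto
      also have "\<dots> \<le> K * (b s * sqrt (2 * t))"
        using True b_nonneg[OF s] K_pos by (intro mult_left_mono) auto
      finally have "b t \<le> K * (b s * sqrt 2)"
        using t by (simp add: real_sqrt_mult mult.assoc[symmetric])
      then show ?thesis using True K_pos by (simp add: field_simps)
    qed (use b_nonneg[OF s] in \<open>auto split: split_indicator\<close>)
    have "ennreal (b t / (K * sqrt 2)) * ennreal c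
        \<le> ennreal (b t / (K * sqrt 2)) * log_norm q (indicator {t<..<2 * t})"
      using t by (intro mult_left_mono c) auto
    also have "\<dots> = log_norm q (\<lambda>s. b t / (K * sqrt 2) * indicator {t<..<2 * t} s)"
      using K_pos b_pos[OF t] by (intro log_norm_cmult[OF q, symmetric]) auto
    also have "\<dots> \<le> tail t"
      unfolding tail_def using le b_pos[OF t] K_pos by (intro log_norm_mono[OF q]) auto
    finally have "ennreal (K * sqrt 2 / c) * (ennreal (b t / (K * sqrt 2)) * ennreal c)
        \<le> ennreal (K * sqrt 2 / c) * tail t"
      by (rule mult_left_mono) simp
    moreover have "ennreal (K * sqrt 2 / c) * (ennreal (b t / (K * sqrt 2)) * ennreal c) = ennreal (b t)"
      using c(1) K_pos b_nonneg[OF t] by (simp flip: ennreal_mult)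
    ultimately show ?thesis by simp
  qed
  then show thesis using c(1) K_pos by (intro that[of "K * sqrt 2 / c"]) auto
qed

text \<open>The half line beyond \<open>s\<close> is split at \<open>t\<close>. Up to
  \<open>t\<close>, \<open>b u\<close> is at most \<open>k / sqrt u\<close>, whose norm beyond
  \<open>s\<close> is a multiple of \<open>sqrt (t / s) * b t\<close>, and
  \<open>weight_le_tail\<close> replaces \<open>b t\<close> by \<open>tail t\<close>. Beyond
  \<open>t\<close> the norm is \<open>tail t\<close> itself.\<close>

lemma tail_sqrt:
  obtains C where "0 < C" "\<And>s t. 0 < s \<Longrightarrow> s \<le> t \<Longrightarrow> tail s \<le> ennreal (C * sqrt (t / s)) * tail t"
proof -
  obtain C1 where C1: "0 < C1" "\<And>t. 0 < t \<Longrightarrow> ennreal (b t) \<le> ennreal C1 * tail t"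
    by (rule weight_le_tail) (rule that)
  obtain C2 where C2: "0 < C2"
    "\<And>r. 0 < r \<Longrightarrow> log_norm q (\<lambda>t. indicator {r<..} t / sqrt t) \<le> ennreal (C2 / sqrt r)"
    by (rule log_norm_sqrt_high[OF q]) (rule that)
  define D where "D = max 1 (K * C2 * C1)"
  have D: "1 \<le> D" "K * C2 * C1 \<le> D" by (simp_all add: D_def)
  have "tail s \<le> ennreal (2 powr recip q * D * sqrt (t / s)) * tail t" if st: "0 < s" "s \<le> t" for s t
  proof -
    define k where "k = K * (b t * sqrt t)"
    have k: "0 < k" using st K_pos b_pos[of t] by (simp add: k_def)
    have "log_norm q (\<lambda>u. k * (indicator {s<..} u / sqrt u))
        = ennreal k * log_norm q (\<lambda>u. indicator {s<..} u / sqrt u)"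
      using k by (intro log_norm_cmult[OF q]) auto
    also have "\<dots> \<le> ennreal k * ennreal (C2 / sqrt s)"
      using st by (intro mult_left_mono C2) auto
    also have "\<dots> = ennreal (K * C2 * sqrt (t / s)) * ennreal (b t)"
      using st K_pos C2 b_nonneg[of t]
      by (simp add: k_def real_sqrt_divide field_simps flip: ennreal_mult)
    also have "\<dots> \<le> ennreal (K * C2 * sqrt (t / s)) * (ennreal C1 * tail t)"
      using st by (intro mult_left_mono C1) auto
    also have "\<dots> = ennreal (K * C2 * C1 * sqrt (t / s)) * tail t"
      using st K_pos C2 C1 by (simp add: ennreal_mult mult_ac)
    also have "\<dots> \<le> ennreal (D * sqrt (t / s)) * tail t"
      using st D(2) by (intro mult_right_mono ennreal_leI) auto
    finally have low: "log_norm q (\<lambda>u. k * (indicator {s<..} u / sqrt u)) \<le> ennreal (D * sqrt (t / s)) * tail t" .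
    \<comment> \<open>Both factors are at least 1, so the bound for the first part also covers the
      part beyond \<open>t\<close>.\<close>
    have "1 * 1 \<le> D * sqrt (t / s)" using D(1) st by (intro mult_mono) auto
    then have high: "1 * tail t \<le> ennreal (D * sqrt (t / s)) * tail t"
      by (intro mult_right_mono) (auto simp flip: ennreal_1 intro: ennreal_leI)
    have "log_norm q (\<lambda>u. b u * indicator {s<..} u) \<le> ennreal (2 powr recip q) * (ennreal (D * sqrt (t / s)) * tail t)"
    proof (rule log_norm_max[OF q, where h = "\<lambda>u. k * (indicator {s<..} u / sqrt u)"
          and k = "\<lambda>u. b u * indicator {t<..} u"])
      fix u :: real assume u: "0 < u"
      show "b u * indicator {s<..} u \<le> k * (indicator {s<..} u / sqrt u)
          \<or> b u * indicator {s<..} u \<le> b u * indicator {t<..} u"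
      proof (cases "s < u \<and> u \<le> t")
        case True
        then have "b u * sqrt u \<le> k" unfolding k_def using u by (intro b_sqrt) auto
        then show ?thesis using True u by (simp add: field_simps)
      qed (auto split: split_indicator)
    qed (use b_nonneg k low high in \<open>auto simp: tail_def\<close>)
    also have "\<dots> = ennreal (2 powr recip q * D * sqrt (t / s)) * tail t"
      using D st by (simp add: ennreal_mult mult_ac)
    finally show ?thesis by (simp add: tail_def)
  qed
  then show thesis using D by (intro that[of "2 powr recip q * D"]) auto
qed

text \<open>The locale only provides finiteness at 1. \<open>tail_sqrt\<close> carries it to smaller
  arguments and monotonicity to larger ones; \<open>min t 1\<close> handles both at once.\<close>

lemma tail_finite: "0 < t \<Longrightarrow> tail t < top"
proof -
  assume "0 < t"
  obtain C where "\<And>s t. 0 < s \<Longrightarrow> s \<le> t \<Longrightarrow> tail s \<le> ennreal (C * sqrt (t / s)) * tail t"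
    by (rule tail_sqrt) (rule that)
  from this[of "min t 1" 1] \<open>0 < t\<close> have "tail (min t 1) \<le> ennreal (C * sqrt (1 / min t 1)) * tail 1"
    by simp
  also have "\<dots> < top" using finite_1 by (simp add: tail_def ennreal_mult_less_top)
  finally show ?thesis using tail_antimono[of "min t 1" t] by (simp add: order_le_less_trans)
qed

lemma tail_pos: "0 < t \<Longrightarrow> 0 < tail t"
proof (rule ccontr)
  assume t: "0 < t" "\<not> 0 < tail t"
  obtain C where "\<And>t. 0 < t \<Longrightarrow> ennreal (b t) \<le> ennreal C * tail t"
    by (rule weight_le_tail) (rule that)
  from this[OF t(1)] t(2) b_pos[OF t(1)] show False by simp
qed

lemma log_norm_min_ge:
  assumes "0 < r"
  shows "ennreal r * tail r \<le> log_norm q (\<lambda>t. b t * min t r)"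
proof -
  have "ennreal r * tail r = log_norm q (\<lambda>t. r * (b t * indicator {r<..} t))"
    unfolding tail_def using assms b_nonneg by (intro log_norm_cmult[OF q, symmetric]) auto
  also have "\<dots> \<le> log_norm q (\<lambda>t. b t * min t r)"
    using assms b_nonneg by (intro log_norm_mono[OF q]) (auto split: split_indicator)
  finally show ?thesis .
qed

text \<open>Up to \<open>r\<close>, almost monotonicity gives
  \<open>b t * t \<le> k * sqrt t\<close>, and the norm of this is a multiple of
  \<open>r * b r\<close>, which \<open>weight_le_tail\<close> bounds by the tail. Beyond
  \<open>r\<close> the function is \<open>r * b t\<close>, with norm exactly
  \<open>r * tail r\<close>.\<close>

lemma log_norm_min_le:
  obtains C where "0 < C"
    "\<And>r. 0 < r \<Longrightarrow> log_norm q (\<lambda>t. b t * min t r) \<le> ennreal C * (ennreal r * tail r)"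
proof -
  obtain C1 where C1: "0 < C1" "\<And>t. 0 < t \<Longrightarrow> ennreal (b t) \<le> ennreal C1 * tail t"
    by (rule weight_le_tail) (rule that)
  obtain C0 where C0: "0 < C0"
    "\<And>r. 0 < r \<Longrightarrow> log_norm q (\<lambda>t. sqrt t * indicator {..r} t) \<le> ennreal (C0 * sqrt r)"
    by (rule log_norm_sqrt_low[OF q]) (rule that)
  define D where "D = max 1 (K * C0 * C1)"
  have D: "1 \<le> D" "K * C0 * C1 \<le> D" by (simp_all add: D_def)
  have "log_norm q (\<lambda>t. b t * min t r) \<le> ennreal (2 powr recip q * D) * (ennreal r * tail r)"
    if r: "0 < r" for r
  proof -
    define k where "k = K * (b r * sqrt r)"
    have k: "0 < k" using r K_pos b_pos[of r] by (simp add: k_def)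
    have "log_norm q (\<lambda>t. k * (sqrt t * indicator {..r} t))
        = ennreal k * log_norm q (\<lambda>t. sqrt t * indicator {..r} t)"
      using k by (intro log_norm_cmult[OF q]) auto
    also have "\<dots> \<le> ennreal k * ennreal (C0 * sqrt r)"
      using r by (intro mult_left_mono C0) auto
    also have "\<dots> = ennreal (K * C0 * r) * ennreal (b r)"
      using r K_pos C0 b_nonneg[of r]
      by (simp add: k_def mult_ac flip: ennreal_mult)
    also have "\<dots> \<le> ennreal (K * C0 * r) * (ennreal C1 * tail r)"
      using r by (intro mult_left_mono C1) auto
    also have "\<dots> = ennreal (K * C0 * C1) * (ennreal r * tail r)"
      using r K_pos C0 C1 by (simp add: ennreal_mult mult_ac)
    also have "\<dots> \<le> ennreal D * (ennreal r * tail r)"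
      using D(2) by (intro mult_right_mono ennreal_leI) auto
    finally have low: "log_norm q (\<lambda>t. k * (sqrt t * indicator {..r} t)) \<le> ennreal D * (ennreal r * tail r)" .
    have "log_norm q (\<lambda>t. r * (b t * indicator {r<..} t)) = 1 * (ennreal r * tail r)"
      unfolding tail_def using r b_nonneg by (subst log_norm_cmult[OF q]) auto
    also have "\<dots> \<le> ennreal D * (ennreal r * tail r)"
      using D(1) by (intro mult_right_mono) (auto simp flip: ennreal_1 intro: ennreal_leI)
    finally have high: "log_norm q (\<lambda>t. r * (b t * indicator {r<..} t)) \<le> ennreal D * (ennreal r * tail r)" .
    have "log_norm q (\<lambda>t. b t * min t r) \<le> ennreal (2 powr recip q) * (ennreal D * (ennreal r * tail r))"
    proof (rule log_norm_max[OF q, where h = "\<lambda>t. k * (sqrt t * indicator {..r} t)"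
          and k = "\<lambda>t. r * (b t * indicator {r<..} t)"])
      fix t :: real assume t: "0 < t"
      show "b t * min t r \<le> k * (sqrt t * indicator {..r} t) \<or> b t * min t r \<le> r * (b t * indicator {r<..} t)"
      proof (cases "t \<le> r")
        case True
        then have "b t * sqrt t \<le> k" unfolding k_def using t by (intro b_sqrt) auto
        then have "b t * sqrt t * sqrt t \<le> k * sqrt t" using t by (intro mult_right_mono) auto
        then show ?thesis using True t by (simp add: mult.assoc)
      qed auto
    qed (use b_nonneg k r low high in auto)
    also have "\<dots> = ennreal (2 powr recip q * D) * (ennreal r * tail r)"
      using D by (simp add: ennreal_mult mult_ac)
    finally show ?thesis .
  qed
  then show thesis using D by (intro that[of "2 powr recip q * D"]) auto
qed

text \<open>Source of the infinite value at infinity. Comparison with \<open>b 1\<close> gives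
  \<open>b t * t \<ge> k * sqrt t\<close> for \<open>1 \<le> t\<close>, so the dyadic interval
  starting at \<open>R\<close> contributes at least \<open>k * sqrt R * c\<close>, which is
  unbounded in \<open>R\<close>.\<close>

lemma log_norm_ident_top: "log_norm q (\<lambda>t. b t * t) = top"
proof (rule ccontr)
  assume "log_norm q (\<lambda>t. b t * t) \<noteq> top"
  then obtain x where x: "log_norm q (\<lambda>t. b t * t) = ennreal x" "0 \<le> x"
    by (cases "log_norm q (\<lambda>t. b t * t)") auto
  obtain c where c: "0 < c" "\<And>r. 0 < r \<Longrightarrow> ennreal c \<le> log_norm q (indicator {r<..<2 * r})"
    by (rule log_norm_dyadic[OF q]) (rule that)
  define k where "k = b 1 / K"
  have k: "0 < k" using K_pos b_pos by (simp add: k_def)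
  have bound: "k * sqrt R * c \<le> x" if R: "1 \<le> R" for R
  proof -
    have le: "k * sqrt R * indicator {R<..<2 * R} t \<le> b t * t" if t: "0 < t" for t
    proof (cases "R < t")
      case True
      have "b 1 * sqrt 1 \<le> K * (b t * sqrt t)" using R True by (intro b_sqrt) auto
      then have "k \<le> b t * sqrt t" using K_pos by (simp add: k_def field_simps)
      then have "k * sqrt R \<le> b t * sqrt t * sqrt t"
        using True R k t by (intro mult_mono) auto
      then show ?thesis using t b_nonneg[OF t] by (auto simp: mult.assoc split: split_indicator)
    qed (use b_nonneg[OF t] t in auto)
    have "ennreal (k * sqrt R) * ennreal c \<le> ennreal (k * sqrt R) * log_norm q (indicator {R<..<2 * R})"
      using R by (intro mult_left_mono c) auto
    also have "\<dots> = log_norm q (\<lambda>t. k * sqrt R * indicator {R<..<2 * R} t)"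
      using k R by (intro log_norm_cmult[OF q, symmetric]) auto
    also have "\<dots> \<le> ennreal x"
      unfolding x(1)[symmetric] using le k R by (intro log_norm_mono[OF q]) auto
    finally show ?thesis using x c k R by (simp add: ennreal_le_iff flip: ennreal_mult)
  qed
  \<comment> \<open>Chosen so that \<open>k * sqrt R * c\<close> is at least \<open>x + 1\<close>;
    the maximum keeps \<open>R\<close> in the range of \<open>bound\<close>.\<close>
  define R where "R = max 1 (((x + 1) / (k * c))\<^sup>2)"
  have "(x + 1) / (k * c) \<le> sqrt R"
    by (intro real_le_rsqrt) (simp add: R_def)
  then have "x + 1 \<le> k * sqrt R * c" using k c by (simp add: field_simps)
  with bound[of R] show False by (simp add: R_def)
qed

section \<open>The fundamental function\<close>

lemma lk_avg_norm_char_fun: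
  assumes "E \<in> sets M" "emeasure M E = ennreal r" "0 \<le> r"
  shows "lk_avg_norm M 1 q (\<lambda>t. ennreal (b t)) (char_fun E) = log_norm q (\<lambda>t. b t * min t r)"
  unfolding lk_avg_norm_def log_norm_def
proof (rule Lq_norm_cong)
  fix t :: real assume t: "0 < t"
  have "avg_rearr M (char_fun E) t = ennreal (min 1 (r / t))"
    using assms t by (simp add: avg_rearr_char_fun divide_ennreal min_def ennreal_le_1)
  moreover have "t powr (recip 1 - recip q) = t powr - recip q * t"
    using t by (simp add: recip_1 powr_diff powr_minus divide_inverse mult.commute)
  moreover have "t * min 1 (r / t) = min t r"
    using t by (simp add: min_def field_simps)
  ultimately show "ennreal (t powr (recip 1 - recip q)) * ennreal (b t) * avg_rearr M (char_fun E) t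
      = ennreal (t powr - recip q * (b t * min t r))"
    using t assms(3) b_nonneg[OF t]
    by (simp add: mult_ac flip: ennreal_mult)
qed

lemma lk_avg_norm_char_fun_top:
  assumes "E \<in> sets M" "emeasure M E = top"
  shows "lk_avg_norm M 1 q (\<lambda>t. ennreal (b t)) (char_fun E) = top"
  unfolding lk_avg_norm_def log_norm_ident_top[symmetric] log_norm_def
proof (rule Lq_norm_cong)
  fix t :: real assume t: "0 < t"
  have "avg_rearr M (char_fun E) t = 1"
    using assms t by (simp add: avg_rearr_char_fun ennreal_top_divide)
  moreover have "t powr (recip 1 - recip q) = t powr - recip q * t"
    using t by (simp add: recip_1 powr_diff powr_minus divide_inverse mult.commute)
  ultimately show "ennreal (t powr (recip 1 - recip q)) * ennreal (b t) * avg_rearr M (char_fun E) t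
      = ennreal (t powr - recip q * (b t * t))"
    using t b_nonneg[OF t] by (simp add: mult_ac flip: ennreal_mult)
qed

end

text \<open>The rearrangement of a characteristic function depends only on the measure of the set,
  so the definite description is unambiguous. Existence of a set of prescribed measure is kept
  separate.\<close>

lemma fundamental_function_eq:
  assumes "E \<in> sets M"
  shows "fundamental_function M (lk_avg_norm M p q w) (emeasure M E) = lk_avg_norm M p q w (char_fun E)"
proof -
  have eq: "lk_avg_norm M p q w (char_fun E') = lk_avg_norm M p q w (char_fun E)"
    if "E' \<in> sets M" "emeasure M E' = emeasure M E" for E'
  proof -
    have "rearr M (char_fun E') = rearr M (char_fun E)"
      using that assms by (simp add: rearr_char_fun fun_eq_iff)
    then show ?thesis by (simp add: lk_avg_norm_def avg_rearr_def)
  qed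
  show ?thesis unfolding fundamental_function_def
  proof (rule the_equality)
    show "\<exists>E'\<in>sets M. emeasure M E' = emeasure M E \<and>
        lk_avg_norm M p q w (char_fun E) = lk_avg_norm M p q w (char_fun E')"
      by (rule bexI[OF _ assms]) simp
    fix v
    assume "\<exists>E'\<in>sets M. emeasure M E' = emeasure M E \<and> v = lk_avg_norm M p q w (char_fun E')"
    then show "v = lk_avg_norm M p q w (char_fun E)"
      by (elim bexE conjE) (simp add: eq)
  qed
qed

section \<open>The endpoint spaces\<close>

lemma Lq_norm_zero:
  assumes "\<And>t. 0 < t \<Longrightarrow> g t = 0"
  shows "Lq_norm q g = 0"
proof -
  have "Lq_norm q g = Lq_norm q (\<lambda>_. 0)" using assms by (rule Lq_norm_cong)
  moreover have "esssup (lebesgue_on {0::real<..}) (\<lambda>_. 0 :: ennreal) \<le> 0"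
    by (rule esssup_I) auto
  ultimately show ?thesis by (simp add: Lq_norm_def ennreal_powr_def)
qed

lemma times_avg_rearr:
  assumes "0 < t"
  shows "ennreal t * avg_rearr M f t = (\<integral>\<^sup>+ s. rearr M f s \<partial>lebesgue_on {0<..<t})"
  using assms unfolding avg_rearr_def
  by (simp add: ennreal_times_divide mult.commute[of "ennreal t"] ennreal_mult_divide_eq)

lemma mono_integral_rearr: "mono (\<lambda>t. \<integral>\<^sup>+ s. rearr M f s \<partial>lebesgue_on {0<..<t})"
  by (auto simp: nn_integral_restrict_space intro!: monoI nn_integral_mono split: split_indicator)

text \<open>For fixed \<open>s\<close> the expression is affine in \<open>t\<close>. Non-negativity
  of \<open>A\<close> bounds the family below for \<open>0 \<le> t\<close>, so that the real infimum
  is a genuine lower bound.\<close>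

lemma concave_on_affine_INF:
  fixes A :: "real \<Rightarrow> real"
  assumes "\<And>s. 0 < s \<Longrightarrow> 0 \<le> A s"
  shows "concave_on {0..} (\<lambda>t. INF s\<in>{0<..}. (t + s) * A s)"
  unfolding concave_on_iff
proof (intro conjI ballI allI impI)
  fix x y u v :: real
  assume xy: "x \<in> {0..}" "y \<in> {0..}" and uv: "0 \<le> u" "0 \<le> v" "u + v = 1"
  have bdd: "bdd_below ((\<lambda>s. (t + s) * A s) ` {0<..})" if "0 \<le> t" for t
    using that assms by (intro bdd_belowI[of _ 0]) auto
  show "u * (INF s\<in>{0<..}. (x + s) * A s) + v * (INF s\<in>{0<..}. (y + s) * A s)
      \<le> (INF s\<in>{0<..}. (u *\<^sub>R x + v *\<^sub>R y + s) * A s)"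
  proof (rule cINF_greatest)
    fix s :: real assume s: "s \<in> {0<..}"
    have "u * (INF s\<in>{0<..}. (x + s) * A s) + v * (INF s\<in>{0<..}. (y + s) * A s)
        \<le> u * ((x + s) * A s) + v * ((y + s) * A s)"
      using uv xy s by (intro add_mono mult_left_mono cINF_lower bdd) auto
    also have "\<dots> = (u * x + v * y + (u + v) * s) * A s" by (simp add: algebra_simps)
    finally show "u * (INF s\<in>{0<..}. (x + s) * A s) + v * (INF s\<in>{0<..}. (y + s) * A s)
        \<le> (u *\<^sub>R x + v *\<^sub>R y + s) * A s" by (simp add: uv)
  qed auto
qed auto

text \<open>Concavity on the segment from 0 to \<open>t\<close>, together with
  \<open>\<psi> 0 = 0\<close>, gives \<open>s / t * \<psi> t \<le> \<psi> s\<close>, which is the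
  monotonicity of the quotient.\<close>

lemma quasi_concave_concave:
  assumes "mono_on {0..} \<psi>" "concave_on {0..} \<psi>" "\<psi> 0 = 0" and pos: "\<And>t. 0 < t \<Longrightarrow> 0 < \<psi> t"
  shows "quasi_concave \<psi>"
  unfolding quasi_concave_def
proof (intro conjI allI impI)
  show "mono_on {0<..} (\<lambda>t. t / \<psi> t)"
  proof (rule mono_onI)
    fix s t :: real assume st: "s \<in> {0<..}" "t \<in> {0<..}" "s \<le> t"
    have "\<psi> ((1 - s / t) *\<^sub>R 0 + (s / t) *\<^sub>R t) \<ge> (1 - s / t) * \<psi> 0 + s / t * \<psi> t"
      using assms(2)[unfolded concave_on_iff, THEN conjunct2, rule_format, of 0 t "1 - s / t" "s / t"] st
      by auto
    then have "s / t * \<psi> t \<le> \<psi> s" using st assms(3) by simp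
    then show "s / \<psi> s \<le> t / \<psi> t" using st pos[of s] pos[of t] by (simp add: field_simps)
  qed
  show "0 \<le> \<psi> t" "\<psi> t = 0 \<longleftrightarrow> t = 0" if "0 \<le> t" for t
    using that pos[of t] assms(3) by (cases "t = 0"; simp)+
qed (use assms(1) in auto)

section \<open>A concave function equivalent to t a(t)\<close>

context sqrt_weight
begin

text \<open>A real-valued copy for use with \<open>concave_on\<close> and real infima; by
  \<open>tail_finite\<close> nothing is lost at positive arguments.\<close>

definition tail_real :: "real \<Rightarrow> real" where "tail_real t = enn2real (tail t)"

lemma tail_eq_tail_real: "0 < t \<Longrightarrow> tail t = ennreal (tail_real t)" and tail_real_pos: "0 < t \<Longrightarrow> 0 < tail_real t"
  using tail_finite[of t] tail_pos[of t] by (auto simp: tail_real_def enn2real_positive_iff)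

lemma tail_real_antimono: "0 < s \<Longrightarrow> s \<le> t \<Longrightarrow> tail_real t \<le> tail_real s"
  unfolding tail_real_def by (intro enn2real_mono tail_antimono tail_finite)

lemma tail_real_sqrt:
  obtains C where "0 < C" "\<And>s t. 0 < s \<Longrightarrow> s \<le> t \<Longrightarrow> tail_real s \<le> C * sqrt (t / s) * tail_real t"
proof -
  obtain C where C: "0 < C" "\<And>s t. 0 < s \<Longrightarrow> s \<le> t \<Longrightarrow> tail s \<le> ennreal (C * sqrt (t / s)) * tail t"
    by (rule tail_sqrt) (rule that)
  have "tail_real s \<le> C * sqrt (t / s) * tail_real t" if "0 < s" "s \<le> t" for s t
    using C(2)[OF that] that C(1) tail_real_pos[of s] tail_real_pos[of t]
    by (simp add: tail_eq_tail_real ennreal_le_iff flip: ennreal_mult)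
  then show thesis by (rule that[OF C(1)])
qed

text \<open>An infimum of affine functions of \<open>t\<close>, hence concave; taking \<open>s = t\<close> in it gives the
  upper bound \<open>2 t a(t)\<close>.\<close>

definition concave_tail :: "real \<Rightarrow> real" where
  "concave_tail t = (INF s\<in>{0<..}. (t + s) * tail_real s)"

lemma bdd_below_concave_tail: "0 \<le> t \<Longrightarrow> bdd_below ((\<lambda>s. (t + s) * tail_real s) ` {0<..})"
  using tail_real_pos by (intro bdd_belowI[of _ 0]) (auto simp: less_imp_le)

lemma mono_concave_tail: "mono_on {0..} concave_tail"
proof (rule mono_onI)
  fix r s :: real assume rs: "r \<in> {0..}" "s \<in> {0..}" "r \<le> s"
  show "concave_tail r \<le> concave_tail s"
    unfolding concave_tail_def
  proof (rule cINF_greatest)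
    fix u :: real assume u: "u \<in> {0<..}"
    have "(INF u\<in>{0<..}. (r + u) * tail_real u) \<le> (r + u) * tail_real u"
      using rs u by (intro cINF_lower bdd_below_concave_tail) auto
    also have "\<dots> \<le> (s + u) * tail_real u"
      using rs u tail_real_pos[of u] by (intro mult_right_mono) auto
    finally show "(INF u\<in>{0<..}. (r + u) * tail_real u) \<le> (s + u) * tail_real u" .
  qed auto
qed

lemma concave_concave_tail: "concave_on {0..} concave_tail"
  unfolding concave_tail_def using tail_real_pos by (intro concave_on_affine_INF) (auto simp: less_imp_le)

lemma concave_tail_nonneg: "0 \<le> t \<Longrightarrow> 0 \<le> concave_tail t"
  unfolding concave_tail_def using tail_real_pos by (intro cINF_greatest) (auto simp: less_imp_le)

text \<open>At \<open>t = 0\<close> the infimum runs over \<open>s * tail_real s\<close>, which for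
  small \<open>s\<close> is at most a multiple of \<open>sqrt s\<close> by
  \<open>tail_real_sqrt\<close>.\<close>

lemma concave_tail_0: "concave_tail 0 = 0"
proof (rule antisym)
  obtain C where C: "0 < C" "\<And>s t. 0 < s \<Longrightarrow> s \<le> t \<Longrightarrow> tail_real s \<le> C * sqrt (t / s) * tail_real t"
    by (rule tail_real_sqrt) (rule that)
  define D where "D = C * tail_real 1"
  have D: "0 < D" using C tail_real_pos by (simp add: D_def)
  have bound: "concave_tail 0 \<le> D * sqrt s" if "0 < s" "s \<le> 1" for s
  proof -
    have "concave_tail 0 \<le> (0 + s) * tail_real s"
      unfolding concave_tail_def using that by (intro cINF_lower bdd_below_concave_tail) auto
    also have "\<dots> \<le> s * (C * sqrt (1 / s) * tail_real 1)"
      using that C(2)[of s 1] by (simp add: mult_left_mono)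
    also have "\<dots> = D * sqrt s"
      using that by (simp add: D_def real_sqrt_divide real_div_sqrt mult_ac divide_simps)
    finally show ?thesis .
  qed
  show "concave_tail 0 \<le> 0"
  proof (rule field_le_epsilon)
    fix e :: real assume "0 < e"
    \<comment> \<open>The square makes \<open>D * sqrt s\<close> at most \<open>e\<close>, and the
      minimum keeps \<open>s\<close> at most 1.\<close>
    define s where "s = (min 1 (e / D))\<^sup>2"
    have "0 < min 1 (e / D)" using \<open>0 < e\<close> D by simp
    then have s: "0 < s" "s \<le> 1" "sqrt s = min 1 (e / D)"
      by (auto simp: s_def power_le_one)
    have "D * sqrt s \<le> D * (e / D)" unfolding s(3) using D by (intro mult_left_mono) auto
    then show "concave_tail 0 \<le> 0 + e" using bound[OF s(1,2)] D by simp
  qed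
qed (simp add: concave_tail_nonneg)

text \<open>For the lower bound each \<open>s\<close> has to be checked. If
  \<open>s \<le> t\<close>, then \<open>tail_real s\<close> is at least \<open>tail_real t\<close>.
  If \<open>s\<close> is larger, \<open>tail_real t\<close> is at most
  \<open>C * (s / t) * tail_real s\<close>, because a square root of a number above 1 is below that
  number.\<close>

lemma concave_tail_equiv: "equiv_on {0<..} (\<lambda>t. ennreal t * tail t) (\<lambda>t. ennreal (concave_tail t))"
proof -
  obtain C where C: "0 < C" "\<And>s t. 0 < s \<Longrightarrow> s \<le> t \<Longrightarrow> tail_real s \<le> C * sqrt (t / s) * tail_real t"
    by (rule tail_real_sqrt) (rule that)
  define D where "D = max 1 C"
  have D: "1 \<le> D" "C \<le> D" by (simp_all add: D_def)
  have lower: "t * tail_real t \<le> D * concave_tail t" if t: "0 < t" for t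
  proof -
    have "t * tail_real t / D \<le> concave_tail t"
      unfolding concave_tail_def
    proof (rule cINF_greatest)
      fix s :: real assume "s \<in> {0<..}"
      then have s: "0 < s" by simp
      have "t * tail_real t \<le> D * ((t + s) * tail_real s)"
      proof (cases "s \<le> t")
        case True
        have "1 * (t * tail_real t) \<le> D * ((t + s) * tail_real s)"
          using s t D tail_real_pos[OF t] tail_real_antimono[OF s True] by (intro mult_mono) auto
        then show ?thesis by simp
      next
        case False
        have "sqrt (s / t) \<le> s / t"
          using False t s by (intro real_le_lsqrt) (auto simp: power2_eq_square field_simps mult_mono)
        then have "C * sqrt (s / t) \<le> D * (s / t)"
          using D C(1) s t by (intro mult_mono) auto
        then have "tail_real t \<le> D * (s / t) * tail_real s"
          using C(2)[of t s] False t s tail_real_pos[OF s]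
          by (meson less_imp_le mult_right_mono not_le order_trans)
        then have "t * tail_real t \<le> t * (D * (s / t) * tail_real s)" using t by (intro mult_left_mono) auto
        also have "\<dots> = D * (s * tail_real s)" using t by simp
        also have "\<dots> \<le> D * ((t + s) * tail_real s)"
          using D t tail_real_pos[OF s] by (intro mult_left_mono mult_right_mono) auto
        finally show ?thesis .
      qed
      then show "t * tail_real t / D \<le> (t + s) * tail_real s" using D by (simp add: field_simps)
    qed auto
    then show ?thesis using D by (simp add: field_simps)
  qed
  have upper: "concave_tail t \<le> 2 * (t * tail_real t)" if t: "0 < t" for t
  proof -
    have "concave_tail t \<le> (t + t) * tail_real t"
      unfolding concave_tail_def using t by (intro cINF_lower bdd_below_concave_tail) auto
    then show ?thesis by (simp add: algebra_simps)
  qed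
  show ?thesis
  proof (rule equiv_onI)
    show "0 < D" using D by simp
    fix t :: real assume "t \<in> {0<..}"
    then have t: "0 < t" by simp
    have "ennreal t * tail t = ennreal (t * tail_real t)"
      using t tail_real_pos[OF t] by (simp add: tail_eq_tail_real ennreal_mult)
    then show "ennreal t * tail t \<le> ennreal D * ennreal (concave_tail t)"
      "ennreal (concave_tail t) \<le> ennreal 2 * (ennreal t * tail t)"
      using lower[OF t] upper[OF t] t D tail_real_pos[OF t] concave_tail_nonneg[of t]
      by (auto simp flip: ennreal_mult simp del: ennreal_numeral intro!: ennreal_leI)
  qed
qed

lemma concave_tail_pos: "0 < t \<Longrightarrow> 0 < concave_tail t"
proof (rule ccontr)
  assume t: "0 < t" "\<not> 0 < concave_tail t"
  obtain C where "\<And>s. s \<in> {0<..} \<Longrightarrow> ennreal s * tail s \<le> ennreal C * ennreal (concave_tail s)"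
    using concave_tail_equiv by (rule equiv_onE) (rule that)
  from this[of t] have "ennreal t * tail t = 0" using t by (simp add: ennreal_neg)
  then show False using t(1) tail_pos[OF t(1)] by simp
qed

section \<open>The measure a(t) dt and the endpoint functionals\<close>

definition tail_measure :: "real measure" where
  "tail_measure = density lborel (\<lambda>s. tail s * indicator {0<..} s)"

lemma tail_measurable [measurable]: "tail \<in> borel_measurable borel"
  using tail_antimono by (intro borel_measurable_monotone_real) (auto simp: antimono_def)

lemma sigma_finite_tail_measure: "sigma_finite_measure tail_measure"
  unfolding tail_measure_def
  by (subst sigma_finite_measure.sigma_finite_iff_density_finite[OF lborel.sigma_finite_measure_axioms])
    (auto intro!: AE_I2 simp: tail_eq_tail_real split: split_indicator)

lemma emeasure_tail_measure:
  "emeasure tail_measure {0..d} = (\<integral>\<^sup>+ s. tail s * indicator {0<..d} s \<partial>lborel)"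
  unfolding tail_measure_def
  by (subst emeasure_density) (auto intro!: nn_integral_cong split: split_indicator)

lemma emeasure_tail_measure_ge:
  assumes "0 < d"
  shows "ennreal d * tail d \<le> emeasure tail_measure {0..d}"
proof -
  have "ennreal d * tail d = (\<integral>\<^sup>+ s. tail d * indicator {0<..d} s \<partial>lborel)"
    using assms by (subst nn_integral_cmult_indicator) (auto simp: mult.commute)
  also have "\<dots> \<le> emeasure tail_measure {0..d}"
    unfolding emeasure_tail_measure
    by (intro nn_integral_mono) (auto intro: tail_antimono split: split_indicator)
  finally show ?thesis .
qed

text \<open>The integrand is at most \<open>C * sqrt d * tail_real d\<close> times
  \<open>s powr (- 1 / 2)\<close>, whose integral from 0 to \<open>d\<close> is
  \<open>2 * sqrt d\<close>; hence the constant \<open>2 * C\<close>.\<close>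

lemma emeasure_tail_measure_le:
  obtains C where "0 < C" "\<And>d. 0 < d \<Longrightarrow> emeasure tail_measure {0..d} \<le> ennreal C * (ennreal d * tail d)"
proof -
  obtain C where C: "0 < C" "\<And>s t. 0 < s \<Longrightarrow> s \<le> t \<Longrightarrow> tail_real s \<le> C * sqrt (t / s) * tail_real t"
    by (rule tail_real_sqrt) (rule that)
  have "emeasure tail_measure {0..d} \<le> ennreal (2 * C) * (ennreal d * tail d)" if d: "0 < d" for d
  proof -
    have "emeasure tail_measure {0..d}
        \<le> (\<integral>\<^sup>+ s. ennreal (C * sqrt d * tail_real d) * (ennreal (s powr (- 1 / 2)) * indicator {0..d} s) \<partial>lborel)"
      unfolding emeasure_tail_measure
    proof (intro nn_integral_mono)
      fix s
      show "tail s * indicator {0<..d} s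
          \<le> ennreal (C * sqrt d * tail_real d) * (ennreal (s powr (- 1 / 2)) * indicator {0..d} s)"
      proof (cases "0 < s \<and> s \<le> d")
        case True
        then have "tail_real s \<le> C * sqrt d * tail_real d * s powr (- 1 / 2)"
          using C(2)[of s d]
          by (simp add: real_sqrt_divide powr_minus powr_half_sqrt field_simps)
        then show ?thesis using True C(1) tail_real_pos[OF d]
          by (simp add: tail_eq_tail_real ennreal_leI flip: ennreal_mult)
      qed (auto split: split_indicator)
    qed
    also have "\<dots> = ennreal (C * sqrt d * tail_real d) * (\<integral>\<^sup>+ s. ennreal (s powr (- 1 / 2)) * indicator {0..d} s \<partial>lborel)"
      supply [measurable del] = ident_measurable_lebesgue_on
      by (intro nn_integral_cmult) measurable
    also have "(\<integral>\<^sup>+ s. ennreal (s powr (- 1 / 2)) * indicator {0..d} s \<partial>lborel) = ennreal (2 * sqrt d)"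
      using has_integral_powr_from_0[of "- 1 / 2" d] d
      by (intro nn_integral_has_integral_lebesgue') (auto simp: powr_half_sqrt mult.commute)
    also have "ennreal (C * sqrt d * tail_real d) * ennreal (2 * sqrt d) = ennreal (2 * C) * (ennreal d * tail d)"
    proof -
      have "C * sqrt d * tail_real d * (2 * sqrt d) = 2 * C * (d * tail_real d)"
        using d by (simp add: algebra_simps flip: power2_eq_square)
      then show ?thesis using d C(1) tail_real_pos[OF d] by (simp add: tail_eq_tail_real flip: ennreal_mult)
    qed
    finally show ?thesis .
  qed
  then show thesis using C(1) by (intro that[of "2 * C"]) auto
qed

text \<open>With both exponents equal to 1 the power of \<open>t\<close> disappears. Including the
  point 0 is harmless because the density vanishes there.\<close>

lemma lk_norm_tail:
  "lk_norm M 1 1 (tail_weight q b) f = (\<integral>\<^sup>+ t\<in>{0..}. rearr M f t \<partial>tail_measure)"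
proof -
  have "lk_norm M 1 1 (tail_weight q b) f = Lq_norm 1 (\<lambda>t. tail t * rearr M f t)"
    unfolding lk_norm_def by (intro Lq_norm_cong) (simp add: tail_weight_eq)
  also have "\<dots> = (\<integral>\<^sup>+ t. tail t * rearr M f t \<partial>lebesgue_on {0<..})"
    by (simp add: Lq_norm_def ennreal_powr_1)
  also have "\<dots> = (\<integral>\<^sup>+ t. tail t * rearr M f t * indicator {0<..} t \<partial>lborel)"
    by (simp add: nn_integral_restrict_space nn_integral_completion)
  also have "\<dots> = (\<integral>\<^sup>+ t. (tail t * indicator {0<..} t) * (rearr M f t * indicator {0..} t) \<partial>lborel)"
    by (intro nn_integral_cong) (auto split: split_indicator)
  also have "\<dots> = (\<integral>\<^sup>+ t\<in>{0..}. rearr M f t \<partial>tail_measure)"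
    unfolding tail_measure_def by (subst nn_integral_density) auto
  finally show ?thesis .
qed

text \<open>Both measures give the interval from 0 to \<open>d\<close> a mass equivalent to
  \<open>d * tail d\<close>, and \<open>rearr\<close> is non-increasing, so
  \<open>nn_integral_antimono_le\<close> applies in each direction.\<close>

lemma lorentz_norm_equiv:
  assumes \<psi>: "mono_on {0..} \<psi>" "concave_on {0..} \<psi>" "\<psi> 0 = 0"
    and "equiv_on {0<..} (\<lambda>t. ennreal t * tail t) (\<lambda>t. ennreal (\<psi> t))"
  shows "equiv_on D (lorentz_norm M \<psi>) (lk_norm M 1 1 (tail_weight q b))"
proof -
  obtain K where K: "0 < K"
    "\<And>t. t \<in> {0<..} \<Longrightarrow> ennreal t * tail t \<le> ennreal K * ennreal (\<psi> t)"
    "\<And>t. t \<in> {0<..} \<Longrightarrow> ennreal (\<psi> t) \<le> ennreal K * (ennreal t * tail t)"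
    using assms(4) by (rule equiv_onE) (rule that)
  have \<psi>_le: "\<psi> t \<le> K * (t * tail_real t)" if "0 < t" for t
    using K(3)[of t] that K(1) tail_real_pos[OF that]
    by (simp add: tail_eq_tail_real ennreal_le_iff flip: ennreal_mult)
  have \<psi>_nonneg: "0 \<le> \<psi> t" if "0 \<le> t" for t
    using mono_onD[OF \<psi>(1), of 0 t] that \<psi>(3) by simp
  obtain C where C: "0 < C" "\<And>s t. 0 < s \<Longrightarrow> s \<le> t \<Longrightarrow> tail_real s \<le> C * sqrt (t / s) * tail_real t"
    by (rule tail_real_sqrt) (rule that)
  \<comment> \<open>Excludes the atom at 0: every representative tends to 0 there at least as fast
    as a multiple of \<open>sqrt t\<close>.\<close>
  have sqrt_bound: "\<psi> t \<le> K * C * tail_real 1 * sqrt t" if "0 < t" "t < 1" for t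
  proof -
    have "K * (t * tail_real t) \<le> K * (t * (C * sqrt (1 / t) * tail_real 1))"
      using that K(1) C(2)[of t 1] by (intro mult_left_mono) auto
    also have "\<dots> = K * C * tail_real 1 * sqrt t"
      using that by (simp add: real_sqrt_divide real_div_sqrt mult_ac divide_simps)
    finally show ?thesis using \<psi>_le[OF that(1)] by simp
  qed
  have "((\<lambda>t. K * C * tail_real 1 * sqrt t) \<longlongrightarrow> K * C * tail_real 1 * sqrt 0) (at_right 0)"
    by (intro tendsto_intros)
  then have "((\<lambda>t. K * C * tail_real 1 * sqrt t) \<longlongrightarrow> 0) (at_right 0)" by simp
  then have lim: "(\<psi> \<longlongrightarrow> 0) (at_right 0)"
  proof (rule tendsto_sandwich[OF _ _ tendsto_const, rotated 2])
    show "\<forall>\<^sub>F t in at_right 0. 0 \<le> \<psi> t"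
      using \<psi>_nonneg by (auto simp: eventually_at_filter)
    show "\<forall>\<^sub>F t in at_right 0. \<psi> t \<le> K * C * tail_real 1 * sqrt t"
      using sqrt_bound unfolding eventually_at_right[OF zero_less_one] by (intro exI[of _ 1]) auto
  qed
  note \<mu> = sigma_finite_stieltjes_measure[OF \<psi> lim] sets_stieltjes_measure[OF \<psi> lim]
    and \<mu>_Icc = emeasure_stieltjes_measure[OF \<psi> lim]
  have \<nu>: "sigma_finite_measure tail_measure" "sets tail_measure = sets borel"
    by (rule sigma_finite_tail_measure) (simp add: tail_measure_def)
  obtain L where L: "0 < L" "\<And>d. 0 < d \<Longrightarrow> emeasure tail_measure {0..d} \<le> ennreal L * (ennreal d * tail d)"
    by (rule emeasure_tail_measure_le) (rule that)
  have le1: "emeasure (stieltjes_measure \<psi>) {0..d} \<le> ennreal K * emeasure tail_measure {0..d}" if "0 \<le> d" for d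
  proof (cases "d = 0")
    case False
    then have "ennreal (\<psi> d) \<le> ennreal K * (ennreal d * tail d)" using that by (intro K) auto
    also have "\<dots> \<le> ennreal K * emeasure tail_measure {0..d}"
      using that False by (intro mult_left_mono emeasure_tail_measure_ge) auto
    finally show ?thesis using that by (simp add: \<mu>_Icc)
  qed (use \<mu>_Icc[of 0] \<psi>(3) in simp)
  have le2: "emeasure tail_measure {0..d} \<le> ennreal (L * K) * emeasure (stieltjes_measure \<psi>) {0..d}" if "0 \<le> d" for d
  proof (cases "d = 0")
    case True
    then show ?thesis by (simp only: emeasure_tail_measure) simp
  next
    case False
    then have "emeasure tail_measure {0..d} \<le> ennreal L * (ennreal d * tail d)" using that by (intro L) auto
    also have "\<dots> \<le> ennreal L * (ennreal K * ennreal (\<psi> d))"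
      using that False by (intro mult_left_mono K) auto
    also have "\<dots> = ennreal (L * K) * emeasure (stieltjes_measure \<psi>) {0..d}"
      using that K(1) L(1) by (simp add: \<mu>_Icc ennreal_mult mult.assoc)
    finally show ?thesis .
  qed
  show ?thesis
  proof (rule equiv_onI)
    fix f
    show "lorentz_norm M \<psi> f \<le> ennreal K * lk_norm M 1 1 (tail_weight q b) f"
      unfolding lorentz_norm_def lk_norm_tail
      by (rule nn_integral_antimono_le[OF rearr_antimono \<mu> \<nu> le1])
    show "lk_norm M 1 1 (tail_weight q b) f \<le> ennreal (L * K) * lorentz_norm M \<psi> f"
      unfolding lorentz_norm_def lk_norm_tail
      by (rule nn_integral_antimono_le[OF rearr_antimono \<nu> \<mu> le2])
  qed (use K in simp)
qed

text \<open>Since \<open>\<psi> t\<close> is equivalent to \<open>t * tail t\<close>, both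
  functionals measure \<open>tail t * I f t\<close>, one by a supremum and the other by an essential
  supremum. Only the bound of the former by the latter needs an argument.\<close>

lemma marcinkiewicz_norm_equiv:
  assumes "equiv_on {0<..} (\<lambda>t. ennreal t * tail t) (\<lambda>t. ennreal (\<psi> t))"
  shows "equiv_on D (marcinkiewicz_norm M \<psi>) (lk_avg_norm M 1 \<infinity> (tail_weight q b))"
proof -
  obtain K where K: "0 < K"
    "\<And>t. t \<in> {0<..} \<Longrightarrow> ennreal t * tail t \<le> ennreal K * ennreal (\<psi> t)"
    "\<And>t. t \<in> {0<..} \<Longrightarrow> ennreal (\<psi> t) \<le> ennreal K * (ennreal t * tail t)"
    using assms by (rule equiv_onE) (rule that)
  obtain C where C: "0 < C" "\<And>s t. 0 < s \<Longrightarrow> s \<le> t \<Longrightarrow> tail s \<le> ennreal (C * sqrt (t / s)) * tail t"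
    by (rule tail_sqrt) (rule that)
  define I where "I f t = (\<integral>\<^sup>+ s. rearr M f s \<partial>lebesgue_on {0<..<t})" for f t
  have I: "ennreal t * avg_rearr M f t = I f t" if "0 < t" for f t
    unfolding I_def using that by (rule times_avg_rearr)
  have I_mono: "mono (I f)" for f unfolding I_def by (rule mono_integral_rearr)
  have [measurable]: "(\<lambda>t. tail t * I f t) \<in> borel_measurable (lebesgue_on {0<..})" for f
  proof (rule borel_measurable_lebesgue_on)
    have [measurable]: "I f \<in> borel_measurable borel"
      using I_mono by (intro borel_measurable_monotone_real) blast
    show "(\<lambda>t. tail t * I f t) \<in> borel_measurable borel" by measurable
  qed
  have norm: "lk_avg_norm M 1 \<infinity> (tail_weight q b) f = esssup (lebesgue_on {0<..}) (\<lambda>t. tail t * I f t)" for f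
  proof -
    have "lk_avg_norm M 1 \<infinity> (tail_weight q b) f = Lq_norm \<infinity> (\<lambda>t. tail t * I f t)"
      unfolding lk_avg_norm_def
      by (intro Lq_norm_cong) (simp add: tail_weight_eq recip_1 recip_top mult_ac flip: I)
    then show ?thesis by (simp add: Lq_norm_def)
  qed
  show ?thesis
  proof (rule equiv_onI)
    fix f
    show "lk_avg_norm M 1 \<infinity> (tail_weight q b) f \<le> ennreal K * marcinkiewicz_norm M \<psi> f"
      unfolding norm
    proof (intro esssup_I AE_I2)
      fix t :: real assume "t \<in> space (lebesgue_on {0<..})"
      then have t: "0 < t" by simp
      have "tail t * I f t = ennreal t * tail t * avg_rearr M f t"
        unfolding I[OF t, symmetric] by (simp add: mult_ac)
      also have "\<dots> \<le> ennreal K * ennreal (\<psi> t) * avg_rearr M f t"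
        using t by (intro mult_right_mono K) auto
      also have "\<dots> \<le> ennreal K * marcinkiewicz_norm M \<psi> f"
        unfolding marcinkiewicz_norm_def mult.assoc using t by (intro mult_left_mono SUP_upper) auto
      finally show "tail t * I f t \<le> ennreal K * marcinkiewicz_norm M \<psi> f" .
    qed measurable
    \<comment> \<open>Since \<open>t f\<^sup>*\<^sup>*(t)\<close> is non-decreasing and \<open>a(t)\<close> is dominated by \<open>a(2t)\<close>, the value at \<open>t\<close>
      is dominated by those at all points of \<open>(t, 2t)\<close>, hence by the essential supremum.\<close>
    show "marcinkiewicz_norm M \<psi> f \<le> ennreal (K * (C * sqrt 2)) * lk_avg_norm M 1 \<infinity> (tail_weight q b) f"
      unfolding marcinkiewicz_norm_def
    proof (rule SUP_least)
      fix t :: real assume "t \<in> {0<..}"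
      then have t: "0 < t" by simp
      obtain s where s: "t < s" "s < 2 * t" "tail s * I f s \<le> lk_avg_norm M 1 \<infinity> (tail_weight q b) f"
        unfolding norm
        by (rule AE_lebesgue_on_obtain[OF esssup_AE, of t "2 * t" "\<lambda>t. tail t * I f t"])
          (use t in \<open>auto intro: that\<close>)
      have "tail t \<le> ennreal (C * sqrt (2 * t / t)) * tail (2 * t)"
        using t by (intro C) auto
      also have "\<dots> \<le> ennreal (C * sqrt 2) * tail s"
        using t s by (auto intro!: mult_left_mono tail_antimono)
      finally have tail_le: "tail t \<le> ennreal (C * sqrt 2) * tail s" .
      have "ennreal (\<psi> t) * avg_rearr M f t \<le> ennreal K * (ennreal t * tail t) * avg_rearr M f t"
        using t by (intro mult_right_mono K) auto
      also have "\<dots> = ennreal K * (tail t * I f t)"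
        unfolding I[OF t, symmetric] by (simp add: mult_ac)
      also have "\<dots> \<le> ennreal K * ((ennreal (C * sqrt 2) * tail s) * I f s)"
        using s(1) by (intro mult_left_mono mult_mono tail_le monoD[OF I_mono]) auto
      also have "\<dots> = ennreal (K * (C * sqrt 2)) * (tail s * I f s)"
        using K(1) C(1) by (simp add: ennreal_mult mult.assoc)
      also have "\<dots> \<le> ennreal (K * (C * sqrt 2)) * lk_avg_norm M 1 \<infinity> (tail_weight q b) f"
        using s(3) by (rule mult_left_mono) simp
      finally show "ennreal (\<psi> t) * avg_rearr M f t
          \<le> ennreal (K * (C * sqrt 2)) * lk_avg_norm M 1 \<infinity> (tail_weight q b) f" .
    qed
  qed (use K C in simp)
qed

end

theorem theorem3p13:
  fixes M :: "'a measure" and q :: ennreal and b :: "real \<Rightarrow> real"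
    and a :: "real \<Rightarrow> ennreal" and \<phi> :: "ennreal \<Rightarrow> ennreal"
  assumes "sigma_finite_measure M" and "non_atomic M" and "emeasure M (space M) = \<infinity>"
    and "0 < q"
    and "slowly_varying b"
    and "Lq_norm q (\<lambda>t. ennreal (t powr (- recip q) * b t * indicator {1<..} t)) < \<infinity>"
    and a_def: "a = tail_weight q b"
    and phi_def: "\<phi> = fundamental_function M (lk_avg_norm M 1 q (\<lambda>t. ennreal (b t)))"
  shows "equiv_on {0<..} (\<lambda>t. \<phi> (ennreal t)) (\<lambda>t. ennreal t * a t) \<and> \<phi> \<infinity> = \<infinity> \<and>
    (\<exists>\<eta>. quasi_concave \<eta> \<and> equiv_on {0..} (\<lambda>t. \<phi> (ennreal t)) (\<lambda>t. ennreal (\<eta> t))) \<and>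
    (\<exists>\<psi>. concave_representative \<phi> \<psi>) \<and>
    (\<forall>\<psi>. concave_representative \<phi> \<psi> \<longrightarrow>
       lorentz_space M \<psi> = lk_space M 1 1 a \<and>
       equiv_on (meas_funs M) (lorentz_norm M \<psi>) (lk_norm M 1 1 a) \<and>
       marcinkiewicz_space M \<psi> = lk_avg_space M 1 \<infinity> a \<and>
       equiv_on (meas_funs M) (marcinkiewicz_norm M \<psi>) (lk_avg_norm M 1 \<infinity> a))"
proof -
  obtain K where K: "0 < K" "\<And>s t. 0 < s \<Longrightarrow> s \<le> t \<Longrightarrow> b s * sqrt s \<le> K * (b t * sqrt t)"
    by (rule slowly_varying_sqrt[OF assms(5)]) (rule that)
  have b: "b \<in> borel_measurable (lebesgue_on {0<..})" "\<forall>t>0. 0 < b t"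
    using assms(5) unfolding slowly_varying_def by blast+
  interpret sqrt_weight q b K
  proof
    show "log_norm q (\<lambda>s. b s * indicator {1<..} s) < top"
      using assms(6) by (simp add: log_norm_def mult.assoc)
  qed (use assms(4) b K in auto)
  have phi_eq: "\<phi> (ennreal r) = log_norm q (\<lambda>t. b t * min t r)" if "0 \<le> r" for r
  proof -
    obtain E where E: "E \<in> sets M" "emeasure M E = ennreal r"
      by (rule non_atomic_obtain_emeasure[OF assms(2,3)]) (rule that)
    then show ?thesis
      unfolding phi_def using fundamental_function_eq[OF E(1), of 1 q "\<lambda>t. ennreal (b t)"]
        lk_avg_norm_char_fun[OF E that] by simp
  qed
  have phi_top: "\<phi> \<infinity> = \<infinity>"
    using fundamental_function_eq[OF sets.top[of M], of 1 q "\<lambda>t. ennreal (b t)"]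
      lk_avg_norm_char_fun_top[OF sets.top[of M]] assms(3) by (simp add: phi_def)
  have phi_0: "\<phi> (ennreal 0) = 0"
    unfolding phi_eq[OF order_refl] log_norm_def by (rule Lq_norm_zero) simp
  have a: "a t = tail t" if "0 < t" for t
    using tail_weight_eq[OF that] by (simp add: a_def)
  obtain C where C: "0 < C"
    "\<And>r. 0 < r \<Longrightarrow> log_norm q (\<lambda>t. b t * min t r) \<le> ennreal C * (ennreal r * tail r)"
    by (rule log_norm_min_le) (rule that)
  have phi: "equiv_on {0<..} (\<lambda>t. \<phi> (ennreal t)) (\<lambda>t. ennreal t * tail t)"
  proof (rule equiv_onI[OF C(1), where C' = 1])
    fix t :: real assume "t \<in> {0<..}"
    then have t: "0 < t" by simp
    show "\<phi> (ennreal t) \<le> ennreal C * (ennreal t * tail t)"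
      using C(2)[OF t] t by (simp add: phi_eq)
    show "ennreal t * tail t \<le> ennreal 1 * \<phi> (ennreal t)"
      using log_norm_min_ge[OF t] t by (simp add: phi_eq)
  qed
  then have phi_a: "equiv_on {0<..} (\<lambda>t. \<phi> (ennreal t)) (\<lambda>t. ennreal t * a t)"
    by (simp add: equiv_on_def a)
  \<comment> \<open>A representative has to be compared on the closed half line; at 0 both functions
    vanish.\<close>
  have equiv: "equiv_on {0..} (\<lambda>t. \<phi> (ennreal t)) (\<lambda>t. ennreal (concave_tail t))"
    by (rule equiv_on_insert_zero[OF equiv_on_trans[OF phi concave_tail_equiv]])
      (use phi_0 concave_tail_0 in auto)
  then have rep: "concave_representative \<phi> concave_tail"
    unfolding concave_representative_def
    using mono_concave_tail concave_concave_tail concave_tail_0 by blast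
  have "quasi_concave concave_tail"
    using mono_concave_tail concave_concave_tail concave_tail_0 concave_tail_pos
    by (rule quasi_concave_concave)
  moreover have "lorentz_space M \<psi> = lk_space M 1 1 a \<and>
       equiv_on (meas_funs M) (lorentz_norm M \<psi>) (lk_norm M 1 1 a) \<and>
       marcinkiewicz_space M \<psi> = lk_avg_space M 1 \<infinity> a \<and>
       equiv_on (meas_funs M) (marcinkiewicz_norm M \<psi>) (lk_avg_norm M 1 \<infinity> a)"
    if "concave_representative \<phi> \<psi>" for \<psi>
  proof -
    have \<psi>: "mono_on {0..} \<psi>" "concave_on {0..} \<psi>" "\<psi> 0 = 0"
      and "equiv_on {0..} (\<lambda>t. \<phi> (ennreal t)) (\<lambda>t. ennreal (\<psi> t))"
      using that unfolding concave_representative_def by blast+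
    then have "equiv_on {0<..} (\<lambda>t. \<phi> (ennreal t)) (\<lambda>t. ennreal (\<psi> t))"
      by (elim equiv_on_subset) auto
    \<comment> \<open>Through the fundamental function every admissible \<open>\<psi>\<close> is
      equivalent to t a(t), so the comparison does not depend on the choice of
      \<open>concave_tail\<close>.\<close>
    then have tail: "equiv_on {0<..} (\<lambda>t. ennreal t * tail t) (\<lambda>t. ennreal (\<psi> t))"
      by (rule equiv_on_trans[OF equiv_on_sym[OF phi]])
    have L: "equiv_on (meas_funs M) (lorentz_norm M \<psi>) (lk_norm M 1 1 a)"
      unfolding a_def by (rule lorentz_norm_equiv[OF \<psi> tail])
    have N: "equiv_on (meas_funs M) (marcinkiewicz_norm M \<psi>) (lk_avg_norm M 1 \<infinity> a)"
      unfolding a_def by (rule marcinkiewicz_norm_equiv[OF tail])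
    have "lorentz_space M \<psi> = lk_space M 1 1 a"
      unfolding lorentz_space_def lk_space_def using equiv_on_finite_iff[OF L] by blast
    moreover have "marcinkiewicz_space M \<psi> = lk_avg_space M 1 \<infinity> a"
      unfolding marcinkiewicz_space_def lk_avg_space_def using equiv_on_finite_iff[OF N] by blast
    ultimately show ?thesis using L N by blast
  qed
  ultimately show ?thesis using phi_a phi_top equiv rep by blast
qed

end
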